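(* Let $(X,d)$ be a complete metric space, let $h\colon[0,\infty)\to[0,\infty)$ be a nondecreasing function with $h(t)>0$ for all $t>0$, and let $\mu\in\mathscr P(X)$. Then there exists a nondecreasing function $\omega\colon[0,\infty)\to[0,\infty)$ with $\omega(t)>0$ for all $t>0$ such that $$\inf_{\lambda\in\Pi(\mu,\nu)}\int_{X\times X} h(d(x,y))\,\mathrm{d}\lambda(x,y)\ \ge\ \omega(W_\infty(\mu,\nu))\qquad\text{for all }\nu\in\mathscr P(\operatorname{supp}\mu)\qquad( * )$$ if and only if $\operatorname{supp}\mu$ is compact and connected. Moreover, in such case one can take as $\omega$ in $( * )$ the function $\omega(t)=\tfrac12\, m(t/17)\,h(t/17)$, where $m(t):=\inf_{x\in\operatorname{supp}\mu}\mu(B(x,t))$.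
   Context: $\mathscr P(X)$ is the set of Borel probability measures on $X$. $\operatorname{supp}\mu$ is the support of $\mu$, i.e. the set of $x\in X$ with $\mu(B(x,r))>0$ for all $r>0$. $\mathscr P(\operatorname{supp}\mu)$ denotes the Borel probability measures living on $\operatorname{supp}\mu$. $B(x,r)$ is the open ball of center $x$ and radius $r$. $\Pi(\mu,\nu)$ is the set of transport plans, i.e. Borel probability measures on $X\times X$ with first marginal $\mu$ and second marginal $\nu$. The $L^\infty$ transportation distance is $W_\infty(\mu,\nu)=\inf_{\lambda\in\Pi(\mu,\nu)}\ \lambda\text{-}\operatorname{ess\,sup}_{(x,y)\in X^2} d(x,y)$, where $\lambda\text{-}\operatorname{ess\,sup}$ is the essential supremum with respect to $\lambda$.
   Formalization: The equivalence is stated only for h(0)=0 (if h(0)>0, the constant ω=h(0) always satisfies ( * )); μ is assumed to satisfy μ(supp μ)=1, automatic for separable X; ω(+∞) is read as the limit of ω at infinity. *)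

theory Defs
  imports "HOL-Probability.Probability" "HOL-Probability.Essential_Supremum"
begin

definition borel_probs :: "'a::topological_space measure set" where
  "borel_probs = {M. sets M = sets borel \<and> prob_space M}"

definition supp :: "'a::metric_space measure \<Rightarrow> 'a set" where
  "supp M = {x. \<forall>r>0. measure M (ball x r) > 0}"

definition borel_probs_on :: "'a::topological_space set \<Rightarrow> 'a measure set" where
  "borel_probs_on S = {M \<in> borel_probs. measure M S = 1}"

text \<open>Plans live on the Borel sigma-algebra of the product topology. If the space is not
  separable, this may be strictly larger than the product sigma-algebra
  \<^term>\<open>borel \<Otimes>\<^sub>M borel\<close>, and the distance need only be measurable for the former.\<close>

definition transport_plans ::
  "'a::topological_space measure \<Rightarrow> 'a measure \<Rightarrow> ('a \<times> 'a) measure set" where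
  "transport_plans M N =
     {L \<in> borel_probs. distr L borel fst = M \<and> distr L borel snd = N}"

definition W_inf :: "'a::metric_space measure \<Rightarrow> 'a measure \<Rightarrow> ennreal" where
  "W_inf M N = (INF L \<in> transport_plans M N. esssup L (\<lambda>(x, y). ennreal (dist x y)))"

definition transport_cost ::
  "(real \<Rightarrow> real) \<Rightarrow> 'a::metric_space measure \<Rightarrow> 'a measure \<Rightarrow> ennreal" where
  "transport_cost h M N =
     (INF L \<in> transport_plans M N. \<integral>\<^sup>+ (x, y). ennreal (h (dist x y)) \<partial>L)"

text \<open>Functions from \<open>[0,\<infinity>)\<close> to \<open>[0,\<infinity>)\<close> are real functions whose values at negative
  arguments are irrelevant.\<close>

definition pos_nondecreasing :: "(real \<Rightarrow> real) \<Rightarrow> bool" where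
  "pos_nondecreasing g \<longleftrightarrow>
     mono_on {0..} g \<and> (\<forall>t\<ge>0. g t \<ge> 0) \<and> (\<forall>t>0. g t > 0)"

text \<open>The distance \<^const>\<open>W_inf\<close> may be infinite when the support is unbounded; a nondecreasing
  function is extended there by its limit at infinity.\<close>

definition at_ennreal :: "(real \<Rightarrow> real) \<Rightarrow> ennreal \<Rightarrow> ennreal" where
  "at_ennreal g w =
     (if w = \<top> then (SUP t \<in> {0..}. ennreal (g t)) else ennreal (g (enn2real w)))"

definition cost_bound ::
  "(real \<Rightarrow> real) \<Rightarrow> 'a::metric_space measure \<Rightarrow> (real \<Rightarrow> real) \<Rightarrow> bool" where
  "cost_bound h M \<omega> \<longleftrightarrow>
     (\<forall>N \<in> borel_probs_on (supp M). transport_cost h M N \<ge> at_ennreal \<omega> (W_inf M N))"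

definition min_ball_mass :: "'a::metric_space measure \<Rightarrow> real \<Rightarrow> real" where
  "min_ball_mass M t = (INF x \<in> supp M. measure M (ball x t))"

end

theory Submission
  imports Defs
begin

text \<open>
  Suppose first that $K = \mathrm{supp}\,\mu$ is compact and connected, and let a plan from \<open>\<mu>\<close> to
  \<open>\<nu>\<close> have small cost. By Markov's inequality it moves a small mass \<open>\<epsilon>\<close> by a distance $s$ or more, so
  \<open>\<mu>(T) \<le> \<nu>(T_s) + \<epsilon>\<close> for every Borel set $T$ and its $s$-neighbourhood $T_s$. The term \<open>\<epsilon>\<close> can be
  removed at the price of a larger neighbourhood: if \<open>\<epsilon>\<close> is at most the smallest mass of a ball of
  radius $s$, apply the inequality to the union of $T$ and one more ball which is disjoint from
  $T$ but near to it; connectedness of $K$ provides the ball. The resulting inequalities are the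
  condition of Hall's marriage theorem, which in its fractional form (\<open>fractional_Hall\<close>), applied to
  a partition of $K$ into finitely many small cells, gives a plan that moves all mass by at
  most $8s$ (\<open>W_inf_le_of_small_defect\<close>). The smallest ball mass is positive by compactness.

  Conversely, let $h(0) = 0$ and let the inequality hold for some \<open>\<omega>\<close>. It is tested on measures \<open>\<nu>\<close> that
  arise from \<open>\<mu>\<close> by moving a fraction of the mass of a bounded set to one point (\<open>mass_move\<close>). If $K$
  splits into two parts at positive distance, an arbitrarily small mass moved from one part to
  the other has arbitrarily small cost, but some mass must cross the gap (\<open>supp_not_separated\<close>).
  So $K$ has no gaps; then a ball can be emptied into a nearby point of $K$. This costs at most a
  constant times the mass of the ball, but it forces a definite \<open>L\<^sup>\<infinity>\<close> distance.
  Hence the balls of a given radius have mass bounded below unless a ball of twice the radius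
  covers $K$. In either case finitely many balls of twice the radius cover $K$, so $K$ is
  totally bounded and, being closed in a complete space, compact (\<open>supp_compact_connected\<close>).

  The space need not be separable, so plans live on a \<open>\<sigma>\<close>-algebra that may be larger than the product
  \<open>\<sigma>\<close>-algebra. Product measures on it are built in \<open>borel_product_exists\<close>.
\<close>

section \<open>A fractional marriage theorem\<close>

text \<open>Think of $a$ as supplies and of $b$ as demands.
  Take an edge with positive supply and demand and ship along it the largest amount \<open>\<epsilon>\<close> that
  keeps the hypothesis true. Either a supply or a demand is used up, or some set \<open>S\<close> of suppliers
  becomes tight, that is, its supply equals the demand of its neighbourhood. In the last case \<open>S\<close>
  with its neighbourhood and the complement of both satisfy the hypothesis separately. Each
  alternative decreases the number of suppliers plus the numbers of nonzero supplies and demands.\<close>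

lemma fractional_Hall:
  fixes a :: "'i \<Rightarrow> real" and b :: "'j \<Rightarrow> real" and R :: "'i \<Rightarrow> 'j \<Rightarrow> bool"
  assumes "finite I" "finite J" "\<And>i. i \<in> I \<Longrightarrow> 0 \<le> a i" "\<And>j. j \<in> J \<Longrightarrow> 0 \<le> b j"
    and "\<And>S. S \<subseteq> I \<Longrightarrow> sum a S \<le> sum b {j \<in> J. \<exists>i\<in>S. R i j}"
  shows "\<exists>p. (\<forall>i\<in>I. \<forall>j\<in>J. 0 \<le> p i j \<and> (p i j \<noteq> 0 \<longrightarrow> R i j)) \<and>
             (\<forall>i\<in>I. (\<Sum>j\<in>J. p i j) = a i) \<and> (\<forall>j\<in>J. (\<Sum>i\<in>I. p i j) \<le> b j)"
  using assms
proof (induction "card I + card {i \<in> I. a i \<noteq> 0} + card {j \<in> J. b j \<noteq> 0}"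
    arbitrary: I J a b rule: less_induct)
  case less
  note fin = less.prems(1,2) and a0 = less.prems(3) and b0 = less.prems(4) and hall = less.prems(5)
  let ?N = "\<lambda>S. {j \<in> J. \<exists>i\<in>S. R i j}"
  have finN: "finite (?N S)" for S using fin by auto
  show ?case
  proof (cases "\<forall>i\<in>I. a i = 0")
    case True
    then show ?thesis using b0 by (intro exI[of _ "\<lambda>_ _. 0"]) auto
  next
    case False
    then obtain i0 where i0: "i0 \<in> I" "a i0 > 0" using a0 by fastforce
    have "0 < sum b (?N {i0})" using hall[of "{i0}"] i0 by auto
    then obtain j0 where j0: "j0 \<in> J" "R i0 j0" "b j0 > 0"
      using b0 sum_nonpos[of "?N {i0}" b] by (force simp: not_less)
    \<comment> \<open>Shipping along the edge affects the condition only for the sets in \<open>T\<close>: they lose demand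
      but no supply.\<close>
    define T where "T = {S. S \<subseteq> I \<and> i0 \<notin> S \<and> (\<exists>i\<in>S. R i j0)}"
    define slack where "slack S = sum b (?N S) - sum a S" for S
    define \<epsilon> where "\<epsilon> = Min ({a i0, b j0} \<union> slack ` T)"
    have finT: "finite T" unfolding T_def using fin by (auto intro: finite_subset[of _ "Pow I"])
    have eps_le: "\<epsilon> \<le> a i0" "\<epsilon> \<le> b j0" "\<And>S. S \<in> T \<Longrightarrow> \<epsilon> \<le> slack S"
      unfolding \<epsilon>_def by (rule Min_le; use finT in auto)+
    have slack0: "0 \<le> slack S" if "S \<in> T" for S using that hall unfolding slack_def T_def by auto
    have "\<epsilon> \<in> {a i0, b j0} \<union> slack ` T" unfolding \<epsilon>_def using finT by (intro Min_in) auto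
    then have eps_cases: "\<epsilon> = a i0 \<or> \<epsilon> = b j0 \<or> (\<exists>S\<in>T. \<epsilon> = slack S)" by blast
    have eps0: "0 \<le> \<epsilon>" using eps_cases i0 j0 slack0 by auto
    define a' where "a' = a(i0 := a i0 - \<epsilon>)"
    define b' where "b' = b(j0 := b j0 - \<epsilon>)"
    have a'0: "0 \<le> a' i" if "i \<in> I" for i using that a0 eps_le unfolding a'_def by auto
    have b'0: "0 \<le> b' j" if "j \<in> J" for j using that b0 eps_le unfolding b'_def by auto
    have suma': "sum a' S = sum a S - (if i0 \<in> S then \<epsilon> else 0)" if "finite S" for S
      unfolding a'_def using that by (auto simp: sum.remove intro!: sum.cong)
    have sumb': "sum b' S = sum b S - (if j0 \<in> S then \<epsilon> else 0)" if "finite S" for S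
      unfolding b'_def using that by (auto simp: sum.remove intro!: sum.cong)
    have hall': "sum a' S \<le> sum b' (?N S)" if S: "S \<subseteq> I" for S
    proof -
      have fS: "finite S" using S fin finite_subset by auto
      have "S \<in> T" if "i0 \<notin> S" "j0 \<in> ?N S" using that S unfolding T_def by auto
      then show ?thesis
        using hall[OF S] eps_le(3)[of S] eps0 j0 unfolding suma'[OF fS] sumb'[OF finN] slack_def
        by (cases "i0 \<in> S"; cases "j0 \<in> ?N S") auto
    qed
    have supp_a': "{i \<in> I. a' i \<noteq> 0} \<subseteq> {i \<in> I. a i \<noteq> 0}"
      using i0 unfolding a'_def by auto
    have supp_b': "{j \<in> J. b' j \<noteq> 0} \<subseteq> {j \<in> J. b j \<noteq> 0}"
      using j0 unfolding b'_def by auto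
    have ca': "card {i \<in> I'. a' i \<noteq> 0} \<le> card {i \<in> I. a i \<noteq> 0}" if "I' \<subseteq> I" for I'
      using that supp_a' fin(1) by (intro card_mono) (simp, blast)
    have cb': "card {j \<in> J'. b' j \<noteq> 0} \<le> card {j \<in> J. b j \<noteq> 0}" if "J' \<subseteq> J" for J'
      using that supp_b' fin(2) by (intro card_mono) (simp, blast)
    have "\<exists>p. (\<forall>i\<in>I. \<forall>j\<in>J. 0 \<le> p i j \<and> (p i j \<noteq> 0 \<longrightarrow> R i j)) \<and>
             (\<forall>i\<in>I. (\<Sum>j\<in>J. p i j) = a' i) \<and> (\<forall>j\<in>J. (\<Sum>i\<in>I. p i j) \<le> b' j)"
    proof (cases "\<epsilon> = a i0 \<or> \<epsilon> = b j0")
      case True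
      have "card {i \<in> I. a' i \<noteq> 0} + card {j \<in> J. b' j \<noteq> 0}
          < card {i \<in> I. a i \<noteq> 0} + card {j \<in> J. b j \<noteq> 0}"
      proof (cases "\<epsilon> = a i0")
        case True
        then have "{i \<in> I. a' i \<noteq> 0} \<subset> {i \<in> I. a i \<noteq> 0}"
          using i0 supp_a' unfolding a'_def by fastforce
        then have "card {i \<in> I. a' i \<noteq> 0} < card {i \<in> I. a i \<noteq> 0}"
          using fin by (intro psubset_card_mono) simp_all
        then show ?thesis using cb'[of J] by auto
      next
        case False
        then have "{j \<in> J. b' j \<noteq> 0} \<subset> {j \<in> J. b j \<noteq> 0}"
          using j0 True supp_b' unfolding b'_def by fastforce
        then have "card {j \<in> J. b' j \<noteq> 0} < card {j \<in> J. b j \<noteq> 0}"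
          using fin by (intro psubset_card_mono) simp_all
        then show ?thesis using ca'[of I] by auto
      qed
      then show ?thesis
        by (intro less.hyps) (use fin a'0 b'0 hall' in simp_all)
    next
      case False
      then obtain S where S: "S \<in> T" "\<epsilon> = slack S" using eps_cases by auto
      have SI: "S \<subseteq> I" "i0 \<notin> S" "j0 \<in> ?N S" using S j0 unfolding T_def by auto
      have fS: "finite S" using SI fin finite_subset by auto
      define NS where "NS = ?N S"
      have NS: "NS \<subseteq> J" "finite NS" "j0 \<in> NS" using finN SI unfolding NS_def by auto
      have tight: "sum a' S = sum b' NS"
        using SI S unfolding NS_def suma'[OF fS] sumb'[OF finN] slack_def by simp
      have "\<exists>p. (\<forall>i\<in>S. \<forall>j\<in>NS. 0 \<le> p i j \<and> (p i j \<noteq> 0 \<longrightarrow> R i j)) \<and>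
             (\<forall>i\<in>S. (\<Sum>j\<in>NS. p i j) = a' i) \<and> (\<forall>j\<in>NS. (\<Sum>i\<in>S. p i j) \<le> b' j)"
      proof (rule less.hyps)
        have "card S < card I" using SI i0 fin by (intro psubset_card_mono) auto
        then show "card S + card {i \<in> S. a' i \<noteq> 0} + card {j \<in> NS. b' j \<noteq> 0}
           < card I + card {i \<in> I. a i \<noteq> 0} + card {j \<in> J. b j \<noteq> 0}"
          using ca'[OF SI(1)] cb'[OF NS(1)] by linarith
        fix U assume "U \<subseteq> S"
        then have "{j \<in> NS. \<exists>i\<in>U. R i j} = ?N U" unfolding NS_def by auto
        then show "sum a' U \<le> sum b' {j \<in> NS. \<exists>i\<in>U. R i j}"
          using hall'[of U] \<open>U \<subseteq> S\<close> SI by auto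
      qed (use fS NS a'0 b'0 SI in auto)
      then obtain p1 where p1: "\<forall>i\<in>S. \<forall>j\<in>NS. 0 \<le> p1 i j \<and> (p1 i j \<noteq> 0 \<longrightarrow> R i j)"
        "\<forall>i\<in>S. (\<Sum>j\<in>NS. p1 i j) = a' i" "\<forall>j\<in>NS. (\<Sum>i\<in>S. p1 i j) \<le> b' j"
        by (elim exE conjE that)
      \<comment> \<open>For the complement, tightness of \<open>S\<close> lets its terms be cancelled from the condition for
        \<open>U \<union> S\<close>.\<close>
      have "\<exists>p. (\<forall>i\<in>I-S. \<forall>j\<in>J-NS. 0 \<le> p i j \<and> (p i j \<noteq> 0 \<longrightarrow> R i j)) \<and>
             (\<forall>i\<in>I-S. (\<Sum>j\<in>J-NS. p i j) = a' i) \<and> (\<forall>j\<in>J-NS. (\<Sum>i\<in>I-S. p i j) \<le> b' j)"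
      proof (rule less.hyps)
        have "card (I - S) < card I" using SI i0 fin by (intro psubset_card_mono) auto
        then show "card (I - S) + card {i \<in> I - S. a' i \<noteq> 0} + card {j \<in> J - NS. b' j \<noteq> 0}
           < card I + card {i \<in> I. a i \<noteq> 0} + card {j \<in> J. b j \<noteq> 0}"
          using ca'[OF Diff_subset, of S] cb'[OF Diff_subset, of NS] by linarith
        fix U assume U: "U \<subseteq> I - S"
        have "?N (U \<union> S) = {j \<in> J - NS. \<exists>i\<in>U. R i j} \<union> NS" unfolding NS_def by auto
        then have "sum b' (?N (U \<union> S)) = sum b' {j \<in> J - NS. \<exists>i\<in>U. R i j} + sum b' NS"
          using fin NS(2) by (auto intro!: sum.union_disjoint)
        moreover have "sum a' (U \<union> S) = sum a' U + sum a' S"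
          using U fin SI by (intro sum.union_disjoint) (auto intro: finite_subset)
        ultimately show "sum a' U \<le> sum b' {j \<in> J - NS. \<exists>i\<in>U. R i j}"
          using hall'[of "U \<union> S"] U SI tight by auto
      qed (use fin a'0 b'0 in auto)
      then obtain p2 where p2: "\<forall>i\<in>I-S. \<forall>j\<in>J-NS. 0 \<le> p2 i j \<and> (p2 i j \<noteq> 0 \<longrightarrow> R i j)"
        "\<forall>i\<in>I-S. (\<Sum>j\<in>J-NS. p2 i j) = a' i" "\<forall>j\<in>J-NS. (\<Sum>i\<in>I-S. p2 i j) \<le> b' j"
        by (elim exE conjE that)
      define p where "p i j = (if i \<in> S then if j \<in> NS then p1 i j else 0
                               else if j \<in> NS then 0 else p2 i j)" for i j
      note NJ = NS(1)
      have split_J: "sum f J = sum f (J - NS) + sum f NS" for f :: "'j \<Rightarrow> real"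
        using sum.subset_diff[OF NJ fin(2)] .
      have split_I: "sum f I = sum f (I - S) + sum f S" for f :: "'i \<Rightarrow> real"
        using sum.subset_diff[OF SI(1) fin(1)] .
      have "0 \<le> p i j \<and> (p i j \<noteq> 0 \<longrightarrow> R i j)" if "i \<in> I" "j \<in> J" for i j
        using that p1(1) p2(1) unfolding p_def by simp
      moreover have "(\<Sum>j\<in>J. p i j) = a' i" if "i \<in> I" for i
      proof (cases "i \<in> S")
        case True
        then have "(\<Sum>j\<in>J-NS. p i j) = 0" "(\<Sum>j\<in>NS. p i j) = (\<Sum>j\<in>NS. p1 i j)"
          unfolding p_def by (auto intro!: sum.neutral sum.cong)
        then show ?thesis unfolding split_J using p1(2) True by auto
      next
        case False
        then have "(\<Sum>j\<in>J-NS. p i j) = (\<Sum>j\<in>J-NS. p2 i j)" "(\<Sum>j\<in>NS. p i j) = 0"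
          unfolding p_def by (auto intro!: sum.neutral sum.cong)
        then show ?thesis unfolding split_J using p2(2) False that by auto
      qed
      moreover have "(\<Sum>i\<in>I. p i j) \<le> b' j" if "j \<in> J" for j
      proof (cases "j \<in> NS")
        case True
        then have "(\<Sum>i\<in>I-S. p i j) = 0" "(\<Sum>i\<in>S. p i j) = (\<Sum>i\<in>S. p1 i j)"
          unfolding p_def by (auto intro!: sum.neutral sum.cong)
        then show ?thesis unfolding split_I using p1(3) True by auto
      next
        case False
        then have "(\<Sum>i\<in>I-S. p i j) = (\<Sum>i\<in>I-S. p2 i j)" "(\<Sum>i\<in>S. p i j) = 0"
          unfolding p_def by (auto intro!: sum.neutral sum.cong)
        then show ?thesis unfolding split_I using p2(3) False that by auto
      qed
      ultimately show ?thesis by blast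
    qed
    then obtain p where p: "\<forall>i\<in>I. \<forall>j\<in>J. 0 \<le> p i j \<and> (p i j \<noteq> 0 \<longrightarrow> R i j)"
        "\<forall>i\<in>I. (\<Sum>j\<in>J. p i j) = a' i" "\<forall>j\<in>J. (\<Sum>i\<in>I. p i j) \<le> b' j"
        by (elim exE conjE that)
    define q where "q i j = p i j + (if i = i0 \<and> j = j0 then \<epsilon> else 0)" for i j
    have "(\<Sum>j\<in>J. q i j) = a i" if "i \<in> I" for i
      using p(2)[rule_format, OF that] fin j0 unfolding q_def a'_def by (cases "i = i0") (auto simp: sum.distrib)
    moreover have "(\<Sum>i\<in>I. q i j) \<le> b j" if "j \<in> J" for j
      using p(3)[rule_format, OF that] fin i0 unfolding q_def b'_def
      by (cases "j = j0") (auto simp: sum.distrib)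
    moreover have "0 \<le> q i j \<and> (q i j \<noteq> 0 \<longrightarrow> R i j)" if "i \<in> I" "j \<in> J" for i j
      using p(1)[rule_format, OF that] eps0 j0 unfolding q_def by auto
    ultimately show ?thesis by blast
  qed
qed

section \<open>Product measures on the Borel sets of a product space\<close>

lemma borel_measurable_fst_snd [measurable]:
  "fst \<in> borel_measurable (borel :: ('a::topological_space \<times> 'b::topological_space) measure)"
  "snd \<in> borel_measurable (borel :: ('a::topological_space \<times> 'b::topological_space) measure)"
  by (intro borel_measurable_continuous_onI continuous_intros)+

lemma borel_measurable_Pair_section:
  "Pair x \<in> borel_measurable (borel :: ('b::topological_space) measure)"
  by (intro borel_measurable_continuous_onI continuous_intros)

lemma borel_Times:
  assumes "A \<in> sets borel" "B \<in> sets borel"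
  shows "A \<times> B \<in> sets (borel :: ('a::topological_space \<times> 'b::topological_space) measure)"
proof -
  have "A \<times> B = (fst -` A \<inter> space borel) \<inter> (snd -` B \<inter> space borel)" by auto
  then show ?thesis using assms borel_measurable_fst_snd[THEN measurable_sets] by auto
qed

text \<open>The section of an open set at a point $x$ is the increasing union of the sets \<open>V i\<close> of those $y$
  that have a neighbourhood $W$ with \<open>U i \<times> W \<subseteq> A\<close>, where \<open>U i\<close> is a decreasing base at $x$. Every
  \<open>V i\<close> stays inside the section while $x$ moves within \<open>U i\<close>, so the measure of the section
  cannot drop abruptly.\<close>

lemma lsc_measure_section:
  fixes N :: "'b::topological_space measure" and A :: "('a::first_countable_topology \<times> 'b) set"
  assumes N: "sets N = sets borel" and A: "open A"
  shows "open {x. c < emeasure N (Pair x -` A)}"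
  proof (subst open_subopen, safe)
  fix x assume c: "c < emeasure N (Pair x -` A)"
  obtain W where W: "\<And>i. open (W i)" "\<And>i. x \<in> W i"
    "\<And>S. open S \<Longrightarrow> x \<in> S \<Longrightarrow> eventually (\<lambda>i. W i \<subseteq> S) sequentially"
    by (rule countable_basis_at_decseq[of x]) blast
  define U where "U i = (\<Inter>k\<le>i::nat. W k)" for i
  have U: "open (U i)" "x \<in> U i" for i unfolding U_def using W by auto
  have decU: "U j \<subseteq> U i" if "i \<le> j" for i j unfolding U_def using that by auto
  have U_sub: "\<exists>i. U i \<subseteq> S" if "open S" "x \<in> S" for S
    using W(3)[OF that] unfolding U_def by (auto simp: eventually_sequentially)
  define V where "V i = \<Union>{W. open W \<and> U i \<times> W \<subseteq> A}" for i
  have openV: "open (V i)" for i unfolding V_def by auto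
  have incV: "incseq V"
  proof (intro monoI)
    fix i j :: nat assume "i \<le> j"
    then have "U j \<times> W \<subseteq> U i \<times> W" for W :: "'b set" using decU by (intro Sigma_mono) auto
    then show "V i \<le> V j" unfolding V_def by (intro Union_mono Collect_mono) blast
  qed
  have "Pair x -` A = (\<Union>i. V i)"
  proof safe
    fix y assume "(x, y) \<in> A"
    then obtain S W where SW: "open S" "open W" "(x, y) \<in> S \<times> W" "S \<times> W \<subseteq> A"
      by (rule open_prod_elim[OF A])
    then obtain i where "U i \<subseteq> S" using U_sub[of S] by auto
    then have "U i \<times> W \<subseteq> A" using SW(4) by auto
    then have "y \<in> V i" using SW unfolding V_def by (intro UnionI[of W]) auto
    then show "y \<in> (\<Union>i. V i)" by (intro UN_I) auto
  next
    fix y i assume "y \<in> V i"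
    then obtain W where "y \<in> W" "U i \<times> W \<subseteq> A" unfolding V_def by auto
    then show "y \<in> Pair x -` A" using U(2)[of i] by auto
  qed
  then have "emeasure N (Pair x -` A) = (SUP i. emeasure N (V i))"
    using openV incV N by (simp add: SUP_emeasure_incseq image_subset_iff)
  then obtain i where i: "c < emeasure N (V i)" using c by (auto simp: less_SUP_iff)
  have "U i \<subseteq> {x. c < emeasure N (Pair x -` A)}"
  proof safe
    fix x' assume "x' \<in> U i"
    then have "V i \<subseteq> Pair x' -` A" unfolding V_def by auto
    moreover have "open (Pair x' -` A)"
      using A by (intro open_vimage continuous_intros)
    ultimately have "emeasure N (V i) \<le> emeasure N (Pair x' -` A)"
      using N by (intro emeasure_mono) auto
    then show "c < emeasure N (Pair x' -` A)" using i by simp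
  qed
  then show "\<exists>T. open T \<and> x \<in> T \<and> T \<subseteq> {x. c < emeasure N (Pair x -` A)}"
    using U by blast
qed

text \<open>The product is needed on all Borel sets of the product topology, which need not be generated by
  rectangles. It is the mixture over $x$ of the images of $N$ under \<open>y \<mapsto> (x, y)\<close>. Measurability
  of this kernel has to be tested on open sets only, where lower semicontinuity gives it.\<close>

lemma borel_product_exists:
  fixes M N :: "'a::first_countable_topology measure"
  assumes M: "M \<in> borel_probs" and N: "N \<in> borel_probs"
  obtains P :: "('a \<times> 'a) measure" where "P \<in> borel_probs"
    "\<And>A B. A \<in> sets borel \<Longrightarrow> B \<in> sets borel \<Longrightarrow> emeasure P (A \<times> B) = emeasure M A * emeasure N B"
proof -
  interpret M: prob_space M using M unfolding borel_probs_def by auto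
  interpret N: prob_space N using N unfolding borel_probs_def by auto
  have [simp, measurable_cong]: "sets M = sets borel" "sets N = sets borel"
    using M N unfolding borel_probs_def by auto
  have [simp]: "space M = UNIV" "space N = UNIV" using sets_eq_imp_space_eq[of M borel] sets_eq_imp_space_eq[of N borel] by auto
  define K where "K x = distr N borel (Pair x)" for x :: 'a
  have Pair_N: "Pair x \<in> measurable N borel" for x :: 'a
    using borel_measurable_Pair_section by (simp cong: measurable_cong_sets)
  have K_eq: "emeasure (K x) S = emeasure N (Pair x -` S)" if "S \<in> sets borel" for x S
    unfolding K_def using that Pair_N by (simp add: emeasure_distr)
  have "K \<in> measurable M (subprob_algebra borel)"
  proof (rule measurable_subprob_algebra_generated)
    show "sets borel = sigma_sets UNIV {S :: ('a \<times> 'a) set. open S}"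
      by (rule sets_borel)
    show "Int_stable {S :: ('a \<times> 'a) set. open S}" by (auto simp: Int_stable_def)
    show "subprob_space (K x)" for x
      unfolding K_def by (intro prob_space_imp_subprob_space N.prob_space_distr Pair_N)
    show "(\<lambda>x. emeasure (K x) S) \<in> borel_measurable M" if "S \<in> {S. open S}" for S
    proof (rule borel_measurableI_greater)
      fix c :: ennreal
      have "open {x. c < emeasure N (Pair x -` S)}"
        using that by (intro lsc_measure_section) auto
      then show "{x \<in> space M. c < emeasure (K x) S} \<in> sets M"
        using that by (simp add: K_eq)
    qed
    show "(\<lambda>x. emeasure (K x) UNIV) \<in> borel_measurable M" by (simp add: K_eq)
  qed (auto simp: K_def)
  note K = this
  define P where "P = M \<bind> K"
  have em: "emeasure P S = (\<integral>\<^sup>+x. emeasure N (Pair x -` S) \<partial>M)" if "S \<in> sets borel" for S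
    unfolding P_def using that by (subst emeasure_bind[OF _ K]) (auto simp: K_eq)
  have setsP: "sets P = sets borel" unfolding P_def by (intro sets_bind_measurable[OF K]) auto
  have rect: "emeasure P (A \<times> B) = emeasure M A * emeasure N B"
    if AB: "A \<in> sets borel" "B \<in> sets borel" for A B
  proof -
    have "emeasure P (A \<times> B) = (\<integral>\<^sup>+x. emeasure N (Pair x -` (A \<times> B)) \<partial>M)"
      using AB by (intro em borel_Times)
    also have "\<dots> = (\<integral>\<^sup>+x. emeasure N B * indicator A x \<partial>M)"
      by (intro nn_integral_cong) (auto simp: vimage_def indicator_def)
    also have "\<dots> = emeasure M A * emeasure N B"
      using AB by (subst nn_integral_cmult_indicator) (auto simp: mult.commute)
    finally show ?thesis .
  qed
  have "emeasure P (space P) = 1"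
    using rect[of UNIV UNIV] sets_eq_imp_space_eq[OF setsP] M.emeasure_space_1 N.emeasure_space_1 by simp
  then have "P \<in> borel_probs" unfolding borel_probs_def using setsP by (auto intro: prob_spaceI)
  then show thesis using rect that by blast
qed

section \<open>Transport plans\<close>

lemma borel_probsD:
  assumes "M \<in> borel_probs"
  shows "prob_space M" "sets M = sets borel" "space M = UNIV"
  using assms sets_eq_imp_space_eq[of M borel] unfolding borel_probs_def by auto

lemma transport_planD:
  assumes "L \<in> transport_plans M N"
  shows "prob_space L" "sets L = sets borel" "space L = UNIV"
    and "A \<in> sets borel \<Longrightarrow> measure M A = measure L (A \<times> UNIV)"
    and "A \<in> sets borel \<Longrightarrow> measure N A = measure L (UNIV \<times> A)"
proof -
  have L: "L \<in> borel_probs" "M = distr L borel fst" "N = distr L borel snd"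
    using assms unfolding transport_plans_def by auto
  note [simp] = borel_probsD(2,3)[OF L(1)]
  show "prob_space L" "sets L = sets borel" "space L = UNIV" using borel_probsD[OF L(1)] by auto
  have m: "fst \<in> measurable L borel" "snd \<in> measurable L borel"
    using borel_measurable_fst_snd by (simp_all cong: measurable_cong_sets)
  assume A: "A \<in> sets borel"
  have f: "fst -` A \<inter> space L = A \<times> UNIV" "snd -` A \<inter> space L = UNIV \<times> A" by auto
  show "measure M A = measure L (A \<times> UNIV)"
    using measure_distr[OF m(1) A] unfolding L(2) f .
  show "measure N A = measure L (UNIV \<times> A)"
    using measure_distr[OF m(2) A] unfolding L(3) f .
qed

lemma transport_plansI:
  assumes "L \<in> borel_probs" "M \<in> borel_probs" "N \<in> borel_probs"
    and "\<And>A. A \<in> sets borel \<Longrightarrow> emeasure L (A \<times> UNIV) = emeasure M A"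
    and "\<And>A. A \<in> sets borel \<Longrightarrow> emeasure L (UNIV \<times> A) = emeasure N A"
  shows "L \<in> transport_plans M N"
proof -
  note [simp] = borel_probsD(2,3)[OF assms(1)] borel_probsD(2,3)[OF assms(2)] borel_probsD(2,3)[OF assms(3)]
  have m: "fst \<in> measurable L borel" "snd \<in> measurable L borel"
    using borel_measurable_fst_snd by (simp_all cong: measurable_cong_sets)
  have "fst -` A \<inter> space L = A \<times> UNIV" "snd -` A \<inter> space L = UNIV \<times> A" for A by auto
  then have "distr L borel fst = M" "distr L borel snd = N"
    using assms(4,5) m by (auto intro!: measure_eqI simp: emeasure_distr)
  then show ?thesis using assms(1) unfolding transport_plans_def by auto
qed

text \<open>On each rectangle of cells the product measure is rescaled to total mass $p_{ij}$; the marginals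
  come out right because the row and column sums of $p$ are the masses of the cells. Where a cell is
  null the scaling factor divides by zero and is $0$; this is consistent because the row or column
  of $p$ vanishes there.\<close>

lemma piecewise_product_plan:
  fixes M N :: "'a::first_countable_topology measure"
  assumes M: "M \<in> borel_probs" and N: "N \<in> borel_probs"
    and fin: "finite I" "finite J"
    and C: "\<And>i. i \<in> I \<Longrightarrow> C i \<in> sets borel" "disjoint_family_on C I" "measure M (\<Union>i\<in>I. C i) = 1"
    and D: "\<And>j. j \<in> J \<Longrightarrow> D j \<in> sets borel" "disjoint_family_on D J" "measure N (\<Union>j\<in>J. D j) = 1"
    and p0: "\<And>i j. i \<in> I \<Longrightarrow> j \<in> J \<Longrightarrow> 0 \<le> p i j"
    and row: "\<And>i. i \<in> I \<Longrightarrow> (\<Sum>j\<in>J. p i j) = measure M (C i)"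
    and col: "\<And>j. j \<in> J \<Longrightarrow> (\<Sum>i\<in>I. p i j) = measure N (D j)"
  obtains L where "L \<in> transport_plans M N"
    "AE z in L. \<exists>i\<in>I. \<exists>j\<in>J. p i j \<noteq> 0 \<and> fst z \<in> C i \<and> snd z \<in> D j"
proof -
  interpret M: prob_space M using borel_probsD M by auto
  interpret N: prob_space N using borel_probsD N by auto
  note [simp] = borel_probsD(2,3)[OF M] borel_probsD(2,3)[OF N]
  obtain P :: "('a \<times> 'a) measure" where P: "P \<in> borel_probs"
    "\<And>A B. A \<in> sets borel \<Longrightarrow> B \<in> sets borel \<Longrightarrow> emeasure P (A \<times> B) = emeasure M A * emeasure N B"
    using borel_product_exists[OF M N] by blast
  note [simp] = borel_probsD(2,3)[OF P(1)]
  define c where "c i j = p i j / (measure M (C i) * measure N (D j))" for i j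
  define f where "f z = (\<Sum>i\<in>I. \<Sum>j\<in>J. ennreal (c i j) * indicator (C i \<times> D j) z)" for z
  define L where "L = density P f"
  have c0: "0 \<le> c i j" if "i \<in> I" "j \<in> J" for i j unfolding c_def using p0 that by auto
  have CD: "C i \<times> D j \<in> sets borel" if "i \<in> I" "j \<in> J" for i j
    using C D that by (intro borel_Times) auto
  have f: "f \<in> borel_measurable P"
    unfolding f_def using CD by (intro borel_measurable_sum borel_measurable_times_ennreal borel_measurable_const borel_measurable_indicator) simp
  have L_rect: "emeasure L (A \<times> B) = ennreal (\<Sum>i\<in>I. \<Sum>j\<in>J. c i j * (measure M (A \<inter> C i) * measure N (B \<inter> D j)))"
    if AB: "A \<in> sets borel" "B \<in> sets borel" for A B
  proof -
    have rect: "(A \<inter> C i) \<times> (B \<inter> D j) \<in> sets P" if "i \<in> I" "j \<in> J" for i j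
      using AB C(1)[OF that(1)] D(1)[OF that(2)] by (simp add: borel_Times)
    then have rect_meas: "(\<lambda>z. ennreal (c i j) * indicator ((A \<inter> C i) \<times> (B \<inter> D j)) z) \<in> borel_measurable P"
      if "i \<in> I" "j \<in> J" for i j
      using that by (intro borel_measurable_times_ennreal borel_measurable_const borel_measurable_indicator)
    have "emeasure L (A \<times> B) = (\<integral>\<^sup>+z. f z * indicator (A \<times> B) z \<partial>P)"
      unfolding L_def using f AB by (intro emeasure_density) (auto intro: borel_Times)
    also have "\<dots> = (\<integral>\<^sup>+z. (\<Sum>i\<in>I. \<Sum>j\<in>J. ennreal (c i j) * indicator ((A \<inter> C i) \<times> (B \<inter> D j)) z) \<partial>P)"
      unfolding f_def sum_distrib_right
      by (intro nn_integral_cong sum.cong refl) (auto simp: indicator_def)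
    also have "\<dots> = (\<Sum>i\<in>I. \<Sum>j\<in>J. \<integral>\<^sup>+z. ennreal (c i j) * indicator ((A \<inter> C i) \<times> (B \<inter> D j)) z \<partial>P)"
      by (subst nn_integral_sum) (auto intro!: borel_measurable_sum rect_meas sum.cong nn_integral_sum)
    also have "\<dots> = (\<Sum>i\<in>I. \<Sum>j\<in>J. ennreal (c i j) * emeasure P ((A \<inter> C i) \<times> (B \<inter> D j)))"
      by (intro sum.cong refl nn_integral_cmult_indicator rect)
    also have "\<dots> = (\<Sum>i\<in>I. \<Sum>j\<in>J. ennreal (c i j * (measure M (A \<inter> C i) * measure N (B \<inter> D j))))"
      using AB C D c0
      by (intro sum.cong refl) (auto simp: P(2) M.emeasure_eq_measure N.emeasure_eq_measure ennreal_mult)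
    also have "\<dots> = (\<Sum>i\<in>I. ennreal (\<Sum>j\<in>J. c i j * (measure M (A \<inter> C i) * measure N (B \<inter> D j))))"
      using c0 by (intro sum.cong refl sum_ennreal) auto
    also have "\<dots> = ennreal (\<Sum>i\<in>I. \<Sum>j\<in>J. c i j * (measure M (A \<inter> C i) * measure N (B \<inter> D j)))"
      using c0 by (intro sum_ennreal sum_nonneg) auto
    finally show ?thesis .
  qed
  have p_le: "p i j \<le> measure M (C i)" "p i j \<le> measure N (D j)" if "i \<in> I" "j \<in> J" for i j
    using that row[of i] col[of j] member_le_sum[of j J "p i"] member_le_sum[of i I "\<lambda>i. p i j"] p0 fin by auto
  have p_zero: "p i j = 0" if "i \<in> I" "j \<in> J" "measure M (C i) = 0 \<or> measure N (D j) = 0" for i j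
    using p_le[OF that(1,2)] p0[OF that(1,2)] that(3) by auto
  have splitM: "measure M A = (\<Sum>i\<in>I. measure M (A \<inter> C i))" if A: "A \<in> sets borel" for A
  proof -
    have "AE x in M. x \<in> (\<Union>i\<in>I. C i)" using C fin by (subst M.prob_eq_1[symmetric]) auto
    then have "measure M A = measure M (\<Union>i\<in>I. A \<inter> C i)"
      using A C fin by (intro M.finite_measure_eq_AE) (auto elim!: eventually_mono)
    also have "\<dots> = (\<Sum>i\<in>I. measure M (A \<inter> C i))"
      using A C fin by (intro M.finite_measure_finite_Union) (auto simp: disjoint_family_on_def)
    finally show ?thesis .
  qed
  have splitN: "measure N A = (\<Sum>j\<in>J. measure N (A \<inter> D j))" if A: "A \<in> sets borel" for A
  proof -
    have "AE x in N. x \<in> (\<Union>j\<in>J. D j)" using D fin by (subst N.prob_eq_1[symmetric]) auto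
    then have "measure N A = measure N (\<Union>j\<in>J. A \<inter> D j)"
      using A D fin by (intro N.finite_measure_eq_AE) (auto elim!: eventually_mono)
    also have "\<dots> = (\<Sum>j\<in>J. measure N (A \<inter> D j))"
      using A D fin by (intro N.finite_measure_finite_Union) (auto simp: disjoint_family_on_def)
    finally show ?thesis .
  qed
  have margM: "emeasure L (A \<times> UNIV) = emeasure M A" if A: "A \<in> sets borel" for A
  proof -
    have "(\<Sum>j\<in>J. c i j * (measure M (A \<inter> C i) * measure N (UNIV \<inter> D j))) = measure M (A \<inter> C i)"
      if i: "i \<in> I" for i
    proof -
      have "measure M (A \<inter> C i) \<le> measure M (C i)" using A C i by (intro M.finite_measure_mono) auto
      then have z: "measure M (A \<inter> C i) = 0" if "measure M (C i) = 0"
        using that measure_nonneg[of M "A \<inter> C i"] by linarith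
      have "(\<Sum>j\<in>J. c i j * (measure M (A \<inter> C i) * measure N (UNIV \<inter> D j))) =
            (\<Sum>j\<in>J. p i j * (measure M (A \<inter> C i) / measure M (C i)))"
        unfolding c_def using p_zero[OF i] by (intro sum.cong refl) (auto simp: z)
      also have "\<dots> = measure M (C i) * (measure M (A \<inter> C i) / measure M (C i))"
        unfolding sum_distrib_right[symmetric] row[OF i] ..
      also have "\<dots> = measure M (A \<inter> C i)" using z by auto
      finally show ?thesis .
    qed
    then show ?thesis
      using A by (subst L_rect) (auto simp: splitM[OF A] M.emeasure_eq_measure)
  qed
  have margN: "emeasure L (UNIV \<times> A) = emeasure N A" if A: "A \<in> sets borel" for A
  proof -
    have "(\<Sum>i\<in>I. c i j * (measure M (UNIV \<inter> C i) * measure N (A \<inter> D j))) = measure N (A \<inter> D j)"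
      if j: "j \<in> J" for j
    proof -
      have "measure N (A \<inter> D j) \<le> measure N (D j)" using A D j by (intro N.finite_measure_mono) auto
      then have z: "measure N (A \<inter> D j) = 0" if "measure N (D j) = 0"
        using that measure_nonneg[of N "A \<inter> D j"] by linarith
      have "(\<Sum>i\<in>I. c i j * (measure M (UNIV \<inter> C i) * measure N (A \<inter> D j))) =
            (\<Sum>i\<in>I. p i j * (measure N (A \<inter> D j) / measure N (D j)))"
        unfolding c_def using p_zero[OF _ j] by (intro sum.cong refl) (auto simp: z)
      also have "\<dots> = measure N (D j) * (measure N (A \<inter> D j) / measure N (D j))"
        unfolding sum_distrib_right[symmetric] col[OF j] ..
      also have "\<dots> = measure N (A \<inter> D j)" using z by auto
      finally show ?thesis .
    qed
    then show ?thesis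
      using A by (subst L_rect, simp, simp, subst sum.swap) (auto simp: splitN[OF A] N.emeasure_eq_measure)
  qed
  have setsL: "sets L = sets borel" unfolding L_def by simp
  have "emeasure L (space L) = 1"
    using margM[of UNIV] sets_eq_imp_space_eq[OF setsL] M.emeasure_space_1 by simp
  then have "L \<in> borel_probs" unfolding borel_probs_def using setsL by (auto intro: prob_spaceI)
  then have "L \<in> transport_plans M N" using M N margM margN by (rule transport_plansI)
  moreover have "AE z in L. \<exists>i\<in>I. \<exists>j\<in>J. p i j \<noteq> 0 \<and> fst z \<in> C i \<and> snd z \<in> D j"
    unfolding L_def AE_density[OF f]
  proof (intro AE_I2 impI, rule ccontr)
    fix z assume z: "0 < f z" "\<not> (\<exists>i\<in>I. \<exists>j\<in>J. p i j \<noteq> 0 \<and> fst z \<in> C i \<and> snd z \<in> D j)"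
    have "ennreal (c i j) * indicator (C i \<times> D j) z = 0" if "i \<in> I" "j \<in> J" for i j
    proof (cases "z \<in> C i \<times> D j")
      case True
      then have "p i j = 0" using z(2) that by (auto simp: mem_Times_iff)
      then show ?thesis by (simp add: c_def)
    qed simp
    then have "f z = 0" unfolding f_def by (intro sum.neutral ballI) auto
    then show False using z by simp
  qed
  ultimately show thesis by (rule that)
qed

lemma borel_measurable_dist_pair:
  "(\<lambda>z. dist (fst z) (snd z)) \<in> borel_measurable (borel :: ('a::metric_space \<times> 'a) measure)"
  by (intro borel_measurable_continuous_onI continuous_intros)

lemma far_pairs_borel:
  "{z. s \<le> dist (fst z) (snd z)} \<in> sets (borel :: ('a::metric_space \<times> 'a) measure)"
proof -
  have "{z \<in> space borel. s \<le> dist (fst z) (snd z)} \<in> sets (borel :: ('a \<times> 'a) measure)"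
    using borel_measurable_dist_pair by (rule borel_measurable_le[OF borel_measurable_const])
  then show ?thesis by simp
qed

text \<open>Of the mass of $A$, at most $N(B)$ can end in $B$, and the plan carries the rest from $A$ to the
  complement of $B$. Applied to a neighbourhood $B$ of $A$, this gives upper bounds for the
  deficit of $N$ near $A$ and lower bounds for \<^const>\<open>W_inf\<close>.\<close>

lemma plan_imbalance:
  assumes L: "L \<in> transport_plans M N" and A: "A \<in> sets borel" and B: "B \<in> sets borel"
  shows "measure M A \<le> measure N B + measure L (A \<times> (- B))"
proof -
  interpret L: prob_space L using transport_planD[OF L] by auto
  note [simp] = transport_planD(2)[OF L]
  have s: "UNIV \<times> B \<in> sets L" "A \<times> (- B) \<in> sets L" using A B by (auto intro!: borel_Times)
  have "measure M A = measure L (A \<times> UNIV)" by (rule transport_planD(4)[OF L A])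
  also have "\<dots> \<le> measure L ((UNIV \<times> B) \<union> (A \<times> (- B)))"
    using s by (intro L.finite_measure_mono) auto
  also have "\<dots> \<le> measure L (UNIV \<times> B) + measure L (A \<times> (- B))"
    using s by (intro measure_Un_le)
  finally show ?thesis using transport_planD(5)[OF L B] by simp
qed

lemma plan_expansion:
  fixes M N :: "'a::metric_space measure"
  assumes L: "L \<in> transport_plans M N" and A: "A \<in> sets borel"
  shows "measure M A \<le> measure N (\<Union>x\<in>A. ball x s) + measure L {z. s \<le> dist (fst z) (snd z)}"
proof -
  interpret L: prob_space L using transport_planD[OF L] by auto
  note [simp] = transport_planD(2,3)[OF L]
  have D: "{z. s \<le> dist (fst z) (snd z)} \<in> sets L" using far_pairs_borel by simp
  have "measure M A \<le> measure N (\<Union>x\<in>A. ball x s) + measure L (A \<times> (- (\<Union>x\<in>A. ball x s)))"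
    by (intro plan_imbalance[OF L] A borel_open open_UN ballI open_ball)
  also have "measure L (A \<times> (- (\<Union>x\<in>A. ball x s))) \<le> measure L {z. s \<le> dist (fst z) (snd z)}"
    using D by (intro L.finite_measure_mono) (auto simp: not_less)
  finally show ?thesis by simp
qed

lemma W_inf_ge:
  fixes M N :: "'a::metric_space measure"
  assumes A: "A \<in> sets borel" and B: "B \<in> sets borel" and less: "measure N B < measure M A"
    and far: "\<And>x y. x \<in> A \<Longrightarrow> y \<notin> B \<Longrightarrow> \<rho> \<le> dist x y"
  shows "ennreal \<rho> \<le> W_inf M N"
  unfolding W_inf_def
proof (rule INF_greatest, rule ccontr)
  fix L assume L: "L \<in> transport_plans M N"
    and "\<not> ennreal \<rho> \<le> esssup L (\<lambda>(x, y). ennreal (dist x y))"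
  then have small: "esssup L (\<lambda>(x, y). ennreal (dist x y)) < ennreal \<rho>" by simp
  have "AE z in L. z \<notin> A \<times> (- B)"
    using esssup_AE[of "\<lambda>(x, y). ennreal (dist x y)" L]
  proof (rule eventually_mono, intro notI)
    fix z assume z: "(case z of (x, y) \<Rightarrow> ennreal (dist x y)) \<le> esssup L (\<lambda>(x, y). ennreal (dist x y))"
      "z \<in> A \<times> (- B)"
    then have "ennreal \<rho> \<le> (case z of (x, y) \<Rightarrow> ennreal (dist x y))"
      using far by (auto intro!: ennreal_leI)
    then show False using z(1) small by simp
  qed
  then have "measure L (A \<times> (- B)) = 0"
    by (intro measure_eq_0_null_sets) (use A B transport_planD(2)[OF L] in \<open>auto simp: AE_iff_null_sets borel_Times\<close>)
  then show False using plan_imbalance[OF L A B] less by simp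
qed

lemma W_inf_le:
  fixes M N :: "'a::metric_space measure"
  assumes L: "L \<in> transport_plans M N" and r: "AE z in L. dist (fst z) (snd z) \<le> r"
  shows "W_inf M N \<le> ennreal r"
proof -
  note [simp] = transport_planD(2)[OF L]
  have "(\<lambda>z. ennreal (dist (fst z) (snd z))) \<in> borel_measurable L"
    using borel_measurable_dist_pair by (simp cong: measurable_cong_sets)
  then have "esssup L (\<lambda>(x, y). ennreal (dist x y)) \<le> ennreal r"
    using r by (intro esssup_I) (auto simp: case_prod_beta elim!: eventually_mono intro!: ennreal_leI)
  then show ?thesis unfolding W_inf_def using L by (intro INF_lower2[OF L])
qed

section \<open>Supports and masses of balls\<close>

lemma supp_closed:
  fixes M :: "'a::metric_space measure"
  assumes M: "M \<in> borel_probs"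
  shows "closed (supp M)"
proof -
  interpret prob_space M using borel_probsD M by auto
  note [simp] = borel_probsD(2)[OF M]
  have "open (- supp M)"
  proof (rule openI)
    fix x assume "x \<in> - supp M"
    then obtain r where r: "r > 0" "measure M (ball x r) = 0"
      unfolding supp_def using zero_less_measure_iff[of M] by auto
    have "y \<notin> supp M" if "y \<in> ball x (r/2)" for y
    proof -
      have "dist x u < r" if "dist y u < r/2" for u
        using dist_triangle[of x u y] that \<open>y \<in> ball x (r/2)\<close> by (simp add: dist_commute)
      then have "measure M (ball y (r/2)) \<le> measure M (ball x r)"
        by (intro finite_measure_mono) auto
      then have "\<not> measure M (ball y (r/2)) > 0" using r by simp
      then show ?thesis unfolding supp_def using r half_gt_zero by blast
    qed
    then have "ball x (r/2) \<subseteq> - supp M" by blast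
    then show "\<exists>e>0. ball x e \<subseteq> - supp M" using r half_gt_zero by blast
  qed
  then show ?thesis by (simp add: closed_def)
qed

lemma min_ball_mass_le:
  assumes "x \<in> supp M" shows "min_ball_mass M t \<le> measure M (ball x t)"
  unfolding min_ball_mass_def using assms by (intro cINF_lower bdd_belowI[of _ 0]) auto

lemma min_ball_mass_pos:
  fixes M :: "'a::metric_space measure"
  assumes M: "M \<in> borel_probs" and K: "compact (supp M)" "supp M \<noteq> {}" and t: "t > 0"
  shows "min_ball_mass M t > 0"
proof -
  interpret prob_space M using borel_probsD M by auto
  note [simp] = borel_probsD(2)[OF M]
  obtain F where F: "F \<subseteq> supp M" "finite F" "supp M \<subseteq> (\<Union>x\<in>F. ball x (t/2))"
    by (rule compactE_image[OF K(1), of "supp M" "\<lambda>x. ball x (t/2)"]) (use t in auto)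
  define c where "c = Min ((\<lambda>x. measure M (ball x (t/2))) ` F)"
  have "F \<noteq> {}" using F K by auto
  then have "c > 0" unfolding c_def using F t by (subst Min_gr_iff) (auto simp: supp_def)
  moreover have "c \<le> min_ball_mass M t" unfolding min_ball_mass_def
  proof (rule cINF_greatest[OF K(2)])
    fix x assume "x \<in> supp M"
    then obtain y where y: "y \<in> F" "dist y x < t/2" using F by auto
    have "dist x u < t" if "dist y u < t/2" for u
      using dist_triangle[of x u y] that y by (simp add: dist_commute)
    then have "measure M (ball y (t/2)) \<le> measure M (ball x t)"
      by (intro finite_measure_mono) auto
    moreover have "c \<le> measure M (ball y (t/2))" unfolding c_def using y F by (intro Min_le) auto
    ultimately show "c \<le> measure M (ball x t)" by simp
  qed
  ultimately show ?thesis by simp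
qed

lemma min_ball_mass_mono:
  assumes M: "M \<in> borel_probs" and K: "supp M \<noteq> {}" and st: "s \<le> t"
  shows "min_ball_mass M s \<le> min_ball_mass M t"
  unfolding min_ball_mass_def
proof (rule cINF_mono[OF K])
  interpret prob_space M using borel_probsD M by auto
  show "\<exists>x'\<in>supp M. measure M (ball x' s) \<le> measure M (ball x t)" if "x \<in> supp M" for x
    using that st borel_probsD(2)[OF M] by (intro bexI[of _ x] finite_measure_mono) auto
qed (auto intro!: bdd_belowI[of _ 0])

section \<open>Compact connected supports\<close>

lemma connected_intermediate_distance:
  fixes K E :: "'a::metric_space set"
  assumes K: "connected K" and E: "E \<noteq> {}" "E \<subseteq> K" and y: "y \<in> K" "\<And>e. e \<in> E \<Longrightarrow> r \<le> dist y e"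
    and s: "0 \<le> s" "s \<le> r"
  obtains x where "x \<in> K" "infdist x E = s"
proof -
  have "connected ((\<lambda>x. infdist x E) ` K)"
    using K by (intro connected_continuous_image continuous_intros)
  moreover obtain e where "e \<in> E" using E by auto
  then have "0 \<in> (\<lambda>x. infdist x E) ` K" using E by (intro image_eqI[of _ _ e]) auto
  moreover have "r \<le> infdist y E" unfolding infdist_notempty[OF E(1)] using y E by (intro cINF_greatest) auto
  ultimately have "{0..infdist y E} \<subseteq> (\<lambda>x. infdist x E) ` K"
    using y by (intro connected_contains_Icc) auto
  then show thesis using s \<open>r \<le> infdist y E\<close> that by force
qed

text \<open>Cut $K$ into finitely many cells of radius $s$ and look for a matrix between cells whose centres are at distance less
  than $6s$; the fractional marriage theorem asks that every union $A$ of cells satisfy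
  $M(A) \<le> N(A')$, where $A'$ is the union of the cells near $A$. The given plan yields
  $M(T) \<le> N(T_s) + \<epsilon>$ for every Borel set $T$, where $T_s$ is the $s$-neighbourhood of $T$ and
  \<open>\<epsilon>\<close> is the mass that it moves by $s$ or more. Connectedness removes the error: unless $A'$ is
  all of $K$, there is a point $x$ of $K$ close to $A$ whose ball of radius $s$ misses $A$, and
  adding this ball to $T = A$ gains a mass of at least \<open>\<epsilon>\<close> on the left hand side.\<close>

lemma W_inf_le_of_small_defect:
  fixes M N :: "'a::metric_space measure"
  assumes M: "M \<in> borel_probs" "measure M K = 1" and N: "N \<in> borel_probs" "measure N K = 1"
    and K: "compact K" "connected K" and s: "s > 0"
    and L: "L \<in> transport_plans M N"
    and small: "\<And>x. x \<in> K \<Longrightarrow> measure L {z. s \<le> dist (fst z) (snd z)} \<le> measure M (ball x s)"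
  shows "W_inf M N \<le> ennreal (8 * s)"
proof -
  interpret M: prob_space M using borel_probsD M by auto
  interpret N: prob_space N using borel_probsD N by auto
  note [simp] = borel_probsD(2,3)[OF M(1)] borel_probsD(2,3)[OF N(1)]
  define \<epsilon> where "\<epsilon> = measure L {z. s \<le> dist (fst z) (snd z)}"
  have K_borel: "K \<in> sets borel" using K by (simp add: borel_compact)
  obtain F where F: "F \<subseteq> K" "finite F" "K \<subseteq> (\<Union>x\<in>F. ball x s)"
    by (rule compactE_image[OF K(1), of K "\<lambda>x. ball x s"]) (use s in auto)
  define n where "n = card F"
  obtain f where f: "bij_betw f {0..<n} F" using ex_bij_betw_nat_finite[OF F(2)] unfolding n_def by auto
  define I where "I = {0..<n}"
  have fI: "f ` I = F" using f unfolding I_def by (auto simp: bij_betw_def)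
  define C where "C = disjointed (\<lambda>i. K \<inter> ball (f i) s)"
  have finI: "finite I" unfolding I_def by simp
  have C_borel: "C i \<in> sets borel" for i
    unfolding C_def disjointed_def using K_borel by auto
  have C_disj: "disjoint_family_on C S" for S
    unfolding C_def using disjoint_family_disjointed by (rule disjoint_family_on_mono[OF subset_UNIV])
  have C_sub: "C i \<subseteq> K" "C i \<subseteq> ball (f i) s" for i
    unfolding C_def using disjointed_subset[of "\<lambda>i. K \<inter> ball (f i) s" i] by auto
  have C_Un: "(\<Union>i\<in>I. C i) = K"
  proof -
    have "(\<Union>i\<in>I. C i) = (\<Union>i\<in>I. K \<inter> ball (f i) s)"
      unfolding C_def I_def by (rule finite_UN_disjointed_eq)
    also have "\<dots> = K \<inter> (\<Union>x\<in>F. ball x s)" unfolding fI[symmetric] by auto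
    finally show ?thesis using F(3) by auto
  qed
  have sumM: "(\<Sum>i\<in>S. measure M (C i)) = measure M (\<Union>i\<in>S. C i)" if "S \<subseteq> I" for S
    using that finI C_borel C_disj finite_subset by (intro M.finite_measure_finite_Union[symmetric]) auto
  have sumN: "(\<Sum>i\<in>S. measure N (C i)) = measure N (\<Union>i\<in>S. C i)" if "S \<subseteq> I" for S
    using that finI C_borel C_disj finite_subset by (intro N.finite_measure_finite_Union[symmetric]) auto
  let ?R = "\<lambda>i j. dist (f i) (f j) < 6 * s"
  have hall: "(\<Sum>i\<in>S. measure M (C i)) \<le> (\<Sum>j\<in>{j \<in> I. \<exists>i\<in>S. ?R i j}. measure N (C j))"
    if S: "S \<subseteq> I" for S
  proof -
    define NS where "NS = {j \<in> I. \<exists>i\<in>S. ?R i j}"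
    define A where "A = (\<Union>i\<in>S. C i)"
    have NS: "NS \<subseteq> I" unfolding NS_def by auto
    have A_borel: "A \<in> sets borel" unfolding A_def using C_borel S finI finite_subset by auto
    have "measure M A \<le> measure N (\<Union>j\<in>NS. C j)"
    proof (cases "S = {} \<or> NS = I")
      case True
      then show ?thesis
      proof
        assume "NS = I"
        then show ?thesis using C_Un N(2) by simp
      qed (simp add: A_def)
    next
      case False
      then obtain j where j: "j \<in> I" "j \<notin> NS" using NS by auto
      have "f j \<in> K" using j fI F by auto
      \<comment> \<open>At distance \<open>2 * s\<close> from the set of centres of \<open>S\<close>, the ball of radius \<open>s\<close> just misses
        the cells, which lie within \<open>s\<close> of their centres.\<close>
      obtain x where x: "x \<in> K" "infdist x (f ` S) = 2 * s"
      proof (rule connected_intermediate_distance[OF K(2), of "f ` S" "f j" "6 * s" "2 * s"])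
        show "f ` S \<subseteq> K" using S fI F by auto
        show "6 * s \<le> dist (f j) e" if "e \<in> f ` S" for e
          using that j S unfolding NS_def by (auto simp: dist_commute not_less)
      qed (use False s \<open>f j \<in> K\<close> in auto)
      have far: "2 * s \<le> dist x (f i)" if "i \<in> S" for i
        using infdist_le[of "f i" "f ` S" x] x that by auto
      have "\<exists>i\<in>S. dist x (f i) < 3 * s"
      proof (rule ccontr)
        assume "\<not> (\<exists>i\<in>S. dist x (f i) < 3 * s)"
        then have "3 * s \<le> infdist x (f ` S)"
          using False by (subst infdist_notempty) (auto intro!: cINF_greatest simp: not_less)
        then show False using x s by simp
      qed
      then obtain i where i: "i \<in> S" "dist x (f i) < 3 * s" by auto
      have "A \<inter> ball x s = {}"
      proof (rule equals0I)
        fix u assume "u \<in> A \<inter> ball x s"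
        then obtain i where "i \<in> S" "dist (f i) u < s" "dist x u < s"
          using C_sub(2) unfolding A_def by force
        then show False using far[of i] dist_triangle[of x "f i" u] by (simp add: dist_commute)
      qed
      then have "measure M A + measure M (ball x s) = measure M (A \<union> ball x s)"
        using A_borel by (intro M.finite_measure_Union[symmetric]) auto
      also have "\<dots> \<le> measure N (\<Union>t\<in>A \<union> ball x s. ball t s) + \<epsilon>"
        unfolding \<epsilon>_def using A_borel by (intro plan_expansion[OF L]) auto
      finally have nbhd: "measure M A \<le> measure N (\<Union>t\<in>A \<union> ball x s. ball t s)"
        using small[OF x(1)] unfolding \<epsilon>_def by simp
      have N_borel: "(\<Union>t\<in>A \<union> ball x s. ball t s) \<in> sets borel"
        by (intro borel_open open_UN ballI open_ball)
      have "measure N (\<Union>t\<in>A \<union> ball x s. ball t s) = measure N (K \<inter> (\<Union>t\<in>A \<union> ball x s. ball t s))"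
      proof (rule N.finite_measure_eq_AE)
        have "AE y in N. y \<in> K" using N K_borel by (subst N.prob_eq_1[symmetric]) auto
        then show "AE y in N. (y \<in> (\<Union>t\<in>A \<union> ball x s. ball t s)) = (y \<in> K \<inter> (\<Union>t\<in>A \<union> ball x s. ball t s))"
          by (auto elim!: eventually_mono)
      qed (use K_borel N_borel in auto)
      also have "\<dots> \<le> measure N (\<Union>j\<in>NS. C j)"
      proof (rule N.finite_measure_mono)
        show "K \<inter> (\<Union>t\<in>A \<union> ball x s. ball t s) \<subseteq> (\<Union>j\<in>NS. C j)"
        proof
          fix y assume "y \<in> K \<inter> (\<Union>t\<in>A \<union> ball x s. ball t s)"
          then obtain t where y: "y \<in> K" "dist t y < s" "t \<in> A \<or> t \<in> ball x s" by auto
          obtain k where k: "k \<in> I" "y \<in> C k" using y C_Un by auto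
          then have ky: "dist (f k) y < s" using C_sub(2)[of k] by auto
          have "\<exists>i\<in>S. dist (f i) t < 4 * s"
            using y(3)
          proof
            assume "t \<in> A"
            then obtain i where "i \<in> S" "dist (f i) t < s" unfolding A_def using C_sub(2) by force
            then show ?thesis using s by (intro bexI[of _ i]) auto
          next
            assume "t \<in> ball x s"
            then show ?thesis using i dist_triangle[of "f i" t x] by (intro bexI[of _ i]) (auto simp: dist_commute)
          qed
          then obtain i where i: "i \<in> S" "dist (f i) t < 4 * s" by auto
          have "dist (f i) (f k) < 6 * s"
            using i y(2) ky dist_triangle[of "f i" "f k" t] dist_triangle[of t "f k" y] by (simp add: dist_commute)
          then show "y \<in> (\<Union>j\<in>NS. C j)" using k i unfolding NS_def by auto
        qed
        show "(\<Union>j\<in>NS. C j) \<in> sets N" using C_borel NS finI finite_subset by auto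
      qed
      finally show ?thesis using nbhd by simp
    qed
    then show ?thesis using sumM[OF S] sumN[OF NS] unfolding NS_def A_def by simp
  qed
  have "\<exists>p. (\<forall>i\<in>I. \<forall>j\<in>I. 0 \<le> p i j \<and> (p i j \<noteq> 0 \<longrightarrow> ?R i j)) \<and>
             (\<forall>i\<in>I. (\<Sum>j\<in>I. p i j) = measure M (C i)) \<and> (\<forall>j\<in>I. (\<Sum>i\<in>I. p i j) \<le> measure N (C j))"
    using hall by (intro fractional_Hall finI) auto
  then obtain p where p: "\<forall>i\<in>I. \<forall>j\<in>I. 0 \<le> p i j \<and> (p i j \<noteq> 0 \<longrightarrow> ?R i j)"
    and row: "\<forall>i\<in>I. (\<Sum>j\<in>I. p i j) = measure M (C i)"
    and col_le: "\<forall>j\<in>I. (\<Sum>i\<in>I. p i j) \<le> measure N (C j)"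
    by (elim exE conjE that)
  \<comment> \<open>Supply and demand both have total mass \<open>1\<close>, so the column inequalities are equalities.\<close>
  have "(\<Sum>j\<in>I. \<Sum>i\<in>I. p i j) = (\<Sum>i\<in>I. \<Sum>j\<in>I. p i j)" by (rule sum.swap)
  also have "\<dots> = (\<Sum>i\<in>I. measure M (C i))" using row by simp
  also have "\<dots> = (\<Sum>j\<in>I. measure N (C j))"
    using sumM[of I] sumN[of I] C_Un M N by simp
  finally have "(\<Sum>i\<in>I. p i j) = measure N (C j)" if "j \<in> I" for j
    using sum_mono_inv[of "\<lambda>j. \<Sum>i\<in>I. p i j" I "\<lambda>j. measure N (C j)"] col_le that finI by simp
  note col = this
  obtain L' where L': "L' \<in> transport_plans M N"
    "AE z in L'. \<exists>i\<in>I. \<exists>j\<in>I. p i j \<noteq> 0 \<and> fst z \<in> C i \<and> snd z \<in> C j"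
    by (rule piecewise_product_plan[OF M(1) N(1) finI finI, of C C p])
      (use C_borel C_disj C_Un M N p row col in auto)
  have "AE z in L'. dist (fst z) (snd z) \<le> 8 * s"
    using L'(2)
  proof (rule eventually_mono)
    fix z assume "\<exists>i\<in>I. \<exists>j\<in>I. p i j \<noteq> 0 \<and> fst z \<in> C i \<and> snd z \<in> C j"
    then obtain i j where ij: "i \<in> I" "j \<in> I" "p i j \<noteq> 0" "fst z \<in> C i" "snd z \<in> C j" by auto
    have "dist (f i) (f j) < 6 * s" using p ij by auto
    moreover have "dist (f i) (fst z) < s" "dist (f j) (snd z) < s" using ij C_sub(2) by force+
    ultimately show "dist (fst z) (snd z) \<le> 8 * s"
      using dist_triangle[of "fst z" "snd z" "f i"] dist_triangle[of "f i" "snd z" "f j"]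
      by (simp add: dist_commute)
  qed
  then show ?thesis by (rule W_inf_le[OF L'(1)])
qed

text \<open>A plan that is cheaper than the claimed bound at $t$ moves, by Markov's inequality, a mass smaller
  than that of any ball of radius $s = t/17$ centred in the support by a distance
  $s$ or more, so \<^const>\<open>W_inf\<close> is at most $8s$, which is less than $t$.\<close>

lemma cost_bound_of_compact_connected:
  fixes M :: "'a::metric_space measure" and h :: "real \<Rightarrow> real"
  assumes h: "pos_nondecreasing h" and M: "M \<in> borel_probs_on (supp M)"
    and K: "compact (supp M)" "connected (supp M)"
  defines "\<omega> \<equiv> \<lambda>t. 1/2 * min_ball_mass M (t/17) * h (t/17)"
  shows "pos_nondecreasing \<omega>" "cost_bound h M \<omega>"
proof -
  have M': "M \<in> borel_probs" "measure M (supp M) = 1" using M unfolding borel_probs_on_def by auto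
  have ne: "supp M \<noteq> {}" using M'(2) by auto
  have m0: "min_ball_mass M t = 0" if "t \<le> 0" for t
    unfolding min_ball_mass_def using ne that by (simp add: ball_empty)
  have m_pos: "min_ball_mass M t > 0" if "t > 0" for t using min_ball_mass_pos[OF M'(1) K(1) ne that] .
  have m_nonneg: "min_ball_mass M t \<ge> 0" for t using m0[of t] m_pos[of t] by (cases "t > 0") auto
  have h': "\<And>s t. 0 \<le> s \<Longrightarrow> s \<le> t \<Longrightarrow> h s \<le> h t" "\<And>t. 0 \<le> t \<Longrightarrow> 0 \<le> h t" "\<And>t. 0 < t \<Longrightarrow> 0 < h t"
    using h unfolding pos_nondecreasing_def mono_on_def by auto
  show "pos_nondecreasing \<omega>"
    unfolding pos_nondecreasing_def mono_on_def \<omega>_def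
    using h' m_pos m_nonneg min_ball_mass_mono[OF M'(1) ne]
    by (auto intro!: mult_mono mult_nonneg_nonneg)
  show "cost_bound h M \<omega>"
    unfolding cost_bound_def
  proof (intro ballI, rule ccontr)
    fix N assume "N \<in> borel_probs_on (supp M)"
    then have N: "N \<in> borel_probs" "measure N (supp M) = 1" unfolding borel_probs_on_def by auto
    assume "\<not> at_ennreal \<omega> (W_inf M N) \<le> transport_cost h M N"
    then have less: "transport_cost h M N < at_ennreal \<omega> (W_inf M N)" by simp
    \<comment> \<open>A real witness \<open>t\<close> also covers an infinite distance, where the bound is a supremum.\<close>
    obtain t where t: "0 \<le> t" "ennreal t \<le> W_inf M N" "transport_cost h M N < ennreal (\<omega> t)"
    proof (cases "W_inf M N = \<top>")
      case True
      then show ?thesis using less that unfolding at_ennreal_def by (auto simp: less_SUP_iff)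
    next
      case False
      then have "ennreal (enn2real (W_inf M N)) = W_inf M N" by (simp add: less_top)
      then show ?thesis using False less that[of "enn2real (W_inf M N)"] unfolding at_ennreal_def
        by simp
    qed
    have "t \<noteq> 0" using t(3) m0[of 0] unfolding \<omega>_def by auto
    define s where "s = t / 17"
    have s: "s > 0" "t = 17 * s" using t(1) \<open>t \<noteq> 0\<close> unfolding s_def by auto
    obtain L where L: "L \<in> transport_plans M N" "(\<integral>\<^sup>+ (x, y). ennreal (h (dist x y)) \<partial>L) < ennreal (\<omega> t)"
      using t(3) unfolding transport_cost_def by (auto simp: INF_less_iff)
    interpret L: prob_space L using transport_planD[OF L(1)] by auto
    define D where "D = {z :: 'a \<times> 'a. s \<le> dist (fst z) (snd z)}"
    have D: "D \<in> sets L"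
      unfolding D_def using far_pairs_borel by (simp add: transport_planD(2)[OF L(1)])
    have "ennreal (h s * measure L D) = ennreal (h s) * emeasure L D"
      using h'(2)[of s] s by (simp add: L.emeasure_eq_measure ennreal_mult)
    also have "\<dots> = (\<integral>\<^sup>+ z. ennreal (h s) * indicator D z \<partial>L)"
      using D by (simp add: nn_integral_cmult_indicator)
    also have "\<dots> \<le> (\<integral>\<^sup>+ (x, y). ennreal (h (dist x y)) \<partial>L)"
      using h'(1) s unfolding D_def
      by (intro nn_integral_mono) (auto simp: indicator_def intro!: ennreal_leI)
    also have "\<dots> < ennreal (\<omega> t)" by (rule L(2))
    finally have "h s * measure L D < \<omega> t"
      using h'(2)[of s] s by (subst (asm) ennreal_less_iff) auto
    then have "h s * measure L D < h s * (1/2 * min_ball_mass M s)" unfolding \<omega>_def s_def by (simp add: algebra_simps)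
    then have "measure L D < 1/2 * min_ball_mass M s" using h'(3)[OF s(1)] by simp
    then have "measure L D \<le> measure M (ball x s)" if "x \<in> supp M" for x
      using min_ball_mass_le[OF that, of s] m_nonneg[of s] by simp
    then have "W_inf M N \<le> ennreal (8 * s)"
      unfolding D_def by (intro W_inf_le_of_small_defect[OF M' N K s(1) L(1)])
    also have "\<dots> < ennreal t" using s by (intro ennreal_lessI) auto
    finally show False using t(2) by simp
  qed
qed

section \<open>Necessity of compactness and connectedness\<close>

text \<open>The test measures: move a fraction \<open>\<theta>\<close> of the mass of $E$ to the point $b$ and leave the rest in
  place. The plan is the law of $(x, y)$ where $x$ has law $M$ and $y$ is $b$ if $x \<in> E$ and an
  independent coin of bias \<open>\<theta>\<close> shows heads, and $y = x$ otherwise. As $h(0) = 0$, only the moved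
  mass costs.\<close>

lemma mass_move:
  fixes M :: "'a::metric_space measure" and h :: "real \<Rightarrow> real"
  assumes h: "pos_nondecreasing h" "h 0 = 0" and M: "M \<in> borel_probs"
    and E: "E \<in> sets borel" "\<And>x. x \<in> E \<Longrightarrow> dist x b \<le> D" and \<theta>: "0 \<le> \<theta>" "\<theta> \<le> 1"
  obtains N where "N \<in> borel_probs"
    "\<And>A. A \<in> sets borel \<Longrightarrow> E \<subseteq> A \<Longrightarrow> b \<notin> A \<Longrightarrow> measure N A = measure M A - \<theta> * measure M E"
    "\<And>A. A \<in> sets borel \<Longrightarrow> b \<in> A \<Longrightarrow> measure M A \<le> measure N A"
    "transport_cost h M N \<le> ennreal (h D * (\<theta> * measure M E))"
proof -
  define U where "U = measure_pmf (bernoulli_pmf \<theta>)"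
  interpret M: prob_space M using borel_probsD M by auto
  interpret U: prob_space U unfolding U_def by (rule prob_space_measure_pmf)
  interpret MU: pair_prob_space M U ..
  have [simp, measurable_cong]: "sets M = sets borel" "sets U = sets (count_space UNIV)"
    using borel_probsD(2)[OF M] unfolding U_def by auto
  have [simp]: "space M = UNIV" "space U = UNIV"
    using borel_probsD(3)[OF M] unfolding U_def by auto
  have U_True: "measure U {True} = \<theta>"
    unfolding U_def using \<theta> by (simp add: measure_pmf_single)
  have MU_rect: "measure (M \<Otimes>\<^sub>M U) (A \<times> B) = measure M A * measure U B" if "A \<in> sets borel" for A B
    using that by (simp add: measure_def U.emeasure_pair_measure_Times enn2real_mult)
  define g where "g z = (if z \<in> E \<times> {True} then (fst z, b) else (fst z, fst z))" for z :: "'a \<times> bool"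
  have ET: "E \<times> {True} \<in> sets (M \<Otimes>\<^sub>M U)" using E by (intro pair_measureI) auto
  have fst_meas: "fst \<in> measurable (M \<Otimes>\<^sub>M U) borel"
    using measurable_fst[of M U] by (simp cong: measurable_cong_sets)
  have g: "g \<in> measurable (M \<Otimes>\<^sub>M U) borel"
    unfolding g_def
  proof (rule measurable_If_set)
    have "(\<lambda>x. (x, b)) \<in> borel_measurable borel" "(\<lambda>x :: 'a. (x, x)) \<in> borel_measurable borel"
      by (intro borel_measurable_continuous_onI continuous_intros)+
    from measurable_compose[OF fst_meas this(1)] measurable_compose[OF fst_meas this(2)]
    show "(\<lambda>z. (fst z, b)) \<in> measurable (M \<Otimes>\<^sub>M U) borel" "(\<lambda>z. (fst z, fst z)) \<in> measurable (M \<Otimes>\<^sub>M U) borel"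
      by auto
    show "E \<times> {True} \<inter> space (M \<Otimes>\<^sub>M U) \<in> sets (M \<Otimes>\<^sub>M U)" using ET by (rule sets.Int[OF _ sets.top])
  qed
  define L where "L = distr (M \<Otimes>\<^sub>M U) borel g"
  define N where "N = distr L borel snd"
  have L: "L \<in> borel_probs"
    unfolding borel_probs_def L_def using g by (auto intro: MU.prob_space_distr)
  have snd_meas: "snd \<in> measurable L borel" and fst_meas': "fst \<in> measurable L borel"
    using borel_measurable_fst_snd unfolding L_def by (simp_all cong: measurable_cong_sets)
  have N: "N \<in> borel_probs"
    unfolding borel_probs_def N_def using prob_space.prob_space_distr[OF borel_probsD(1)[OF L] snd_meas] by auto
  have "distr L borel fst = distr (M \<Otimes>\<^sub>M U) borel (\<lambda>z. fst (g z))"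
    unfolding L_def using g borel_measurable_fst_snd by (subst distr_distr) (auto simp: comp_def)
  also have "\<dots> = distr (M \<Otimes>\<^sub>M U) M fst"
    by (intro distr_cong) (auto simp: g_def)
  also have "\<dots> = M" by (rule U.distr_pair_fst)
  finally have plan: "L \<in> transport_plans M N" unfolding transport_plans_def N_def using L by auto
  have N_eq: "measure N A = measure (M \<Otimes>\<^sub>M U) {z. snd (g z) \<in> A}" if "A \<in> sets borel" for A
  proof -
    have "N = distr (M \<Otimes>\<^sub>M U) borel (\<lambda>z. snd (g z))"
      unfolding N_def L_def using g borel_measurable_fst_snd by (subst distr_distr) (auto simp: comp_def)
    moreover have "(\<lambda>z. snd (g z)) \<in> measurable (M \<Otimes>\<^sub>M U) borel"
      by (rule measurable_compose[OF g borel_measurable_fst_snd(2)])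
    ultimately show ?thesis using that by (simp add: measure_distr vimage_def space_pair_measure)
  qed
  have "measure N A = measure M A - \<theta> * measure M E" if A: "A \<in> sets borel" "E \<subseteq> A" "b \<notin> A" for A
  proof -
    have "{z. snd (g z) \<in> A} = A \<times> UNIV - E \<times> {True}" using A unfolding g_def by auto
    moreover have "A \<times> UNIV \<in> sets (M \<Otimes>\<^sub>M U)" using A by (intro pair_measureI) auto
    ultimately have "measure N A = measure (M \<Otimes>\<^sub>M U) (A \<times> UNIV) - measure (M \<Otimes>\<^sub>M U) (E \<times> {True})"
      using A ET by (simp only: N_eq) (intro MU.finite_measure_Diff, auto)
    then show ?thesis
      using A(1) E(1) U_True U.prob_space by (simp add: MU_rect)
  qed
  moreover have "measure M A \<le> measure N A" if A: "A \<in> sets borel" "b \<in> A" for A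
  proof -
    have "(\<lambda>z. snd (g z)) \<in> measurable (M \<Otimes>\<^sub>M U) borel"
      by (rule measurable_compose[OF g borel_measurable_fst_snd(2)])
    from measurable_sets[OF this A(1)] have "{z. snd (g z) \<in> A} \<in> sets (M \<Otimes>\<^sub>M U)"
      by (simp add: vimage_def space_pair_measure)
    then have "measure (M \<Otimes>\<^sub>M U) (A \<times> UNIV) \<le> measure (M \<Otimes>\<^sub>M U) {z. snd (g z) \<in> A}"
      using A unfolding g_def by (intro MU.finite_measure_mono) auto
    then show ?thesis using A U.prob_space by (simp add: N_eq MU_rect)
  qed
  moreover have "transport_cost h M N \<le> ennreal (h D * (\<theta> * measure M E))"
  proof -
    have h': "\<And>s t. 0 \<le> s \<Longrightarrow> s \<le> t \<Longrightarrow> h s \<le> h t"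
      using h unfolding pos_nondecreasing_def mono_on_def by auto
    \<comment> \<open>The values of \<open>h\<close> at negative arguments are arbitrary and may spoil measurability.\<close>
    have "mono (\<lambda>t. h (max 0 t))" by (intro monoI h') auto
    then have "(\<lambda>t. h (max 0 t)) \<in> borel_measurable borel" by (rule borel_measurable_mono)
    from measurable_compose[OF measurable_compose[OF borel_measurable_dist_pair this] measurable_ennreal]
    have hm: "(\<lambda>z. ennreal (h (dist (fst z) (snd z)))) \<in> borel_measurable (borel :: ('a \<times> 'a) measure)" by simp
    have "transport_cost h M N \<le> (\<integral>\<^sup>+ (x, y). ennreal (h (dist x y)) \<partial>L)"
      unfolding transport_cost_def by (rule INF_lower[OF plan])
    also have "\<dots> = (\<integral>\<^sup>+ z. ennreal (h (dist (fst (g z)) (snd (g z)))) \<partial>(M \<Otimes>\<^sub>M U))"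
      unfolding L_def case_prod_beta using hm by (intro nn_integral_distr g) auto
    also have "\<dots> \<le> (\<integral>\<^sup>+ z. ennreal (h D) * indicator (E \<times> {True}) z \<partial>(M \<Otimes>\<^sub>M U))"
      using E(2) h(2) by (intro nn_integral_mono) (auto simp: g_def indicator_def intro!: ennreal_leI h')
    also have "\<dots> = ennreal (h D) * emeasure (M \<Otimes>\<^sub>M U) (E \<times> {True})"
      using ET by (rule nn_integral_cmult_indicator)
    also have "\<dots> = ennreal (h D) * ennreal (\<theta> * measure M E)"
      using E U_True by (simp add: MU.emeasure_eq_measure MU_rect mult.commute)
    also have "\<dots> = ennreal (h D * (\<theta> * measure M E))"
      using \<theta> by (intro ennreal_mult''[symmetric]) auto
    finally show ?thesis .
  qed
  ultimately show thesis using that N by blast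
qed

lemma cost_ge_of_W_inf_ge:
  assumes bound: "cost_bound h M \<omega>" "pos_nondecreasing \<omega>" and N: "N \<in> borel_probs_on (supp M)"
    and \<rho>: "0 \<le> \<rho>" "ennreal \<rho> \<le> W_inf M N"
  shows "ennreal (\<omega> \<rho>) \<le> transport_cost h M N"
proof -
  have mono: "\<omega> s \<le> \<omega> t" if "0 \<le> s" "s \<le> t" for s t
    using that bound unfolding pos_nondecreasing_def mono_on_def by auto
  have "ennreal (\<omega> \<rho>) \<le> at_ennreal \<omega> (W_inf M N)"
  proof (cases "W_inf M N = \<top>")
    case True
    then show ?thesis using \<rho> unfolding at_ennreal_def by (auto intro!: SUP_upper)
  next
    case False
    then have "\<rho> \<le> enn2real (W_inf M N)"
      using \<rho> by (metis ennreal_enn2real ennreal_le_iff enn2real_nonneg less_top)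
    then show ?thesis using False \<rho> mono unfolding at_ennreal_def by (auto intro!: ennreal_leI)
  qed
  also have "\<dots> \<le> transport_cost h M N" using bound N unfolding cost_bound_def by auto
  finally show ?thesis .
qed

text \<open>If the support splits into two parts at positive distance \<open>\<rho>\<close>, move a fraction \<open>\<theta>\<close> of a bounded
  piece of the first part to a point of the second. However small \<open>\<theta>\<close> is, some mass has to jump
  across the gap, so \<^const>\<open>W_inf\<close> stays at least \<open>\<rho>\<close> while the cost tends to $0$ with \<open>\<theta>\<close>. Using
  a bounded piece keeps the cost finite if the parts are unbounded.\<close>

lemma supp_not_separated:
  fixes M :: "'a::metric_space measure" and h \<omega> :: "real \<Rightarrow> real"
  assumes h: "pos_nondecreasing h" "h 0 = 0" and M: "M \<in> borel_probs_on (supp M)"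
    and \<omega>: "pos_nondecreasing \<omega>" "cost_bound h M \<omega>"
    and AB: "closed A" "closed B" "A \<union> B = supp M" "A \<noteq> {}" "B \<noteq> {}"
    and \<rho>: "0 < \<rho>" "\<And>x y. x \<in> A \<Longrightarrow> y \<in> B \<Longrightarrow> \<rho> \<le> dist x y"
  shows False
proof -
  have M': "M \<in> borel_probs" "measure M (supp M) = 1" using M unfolding borel_probs_on_def by auto
  interpret M: prob_space M using borel_probsD M' by auto
  note [simp] = borel_probsD(2,3)[OF M'(1)]
  obtain a b where ab: "a \<in> A" "b \<in> B" using AB by auto
  have disj: "A \<inter> B = {}" using \<rho> by fastforce
  define E where "E = A \<inter> ball a \<rho>"
  define D where "D = dist a b + \<rho>"
  have AB_borel [simp]: "A \<in> sets borel" "B \<in> sets borel" "- B \<in> sets borel"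
    using AB by (auto intro: borel_comp)
  have E_borel [simp]: "E \<in> sets borel" unfolding E_def by auto
  have S_borel [simp]: "supp M \<in> sets borel" using supp_closed[OF M'(1)] by auto
  have ED: "dist x b \<le> D" if "x \<in> E" for x
    using that dist_triangle[of x b a] unfolding E_def D_def by (auto simp: dist_commute)
  have AE_supp: "AE x in M. x \<in> supp M" using M' by (subst M.prob_eq_1[symmetric]) auto
  have "measure M E = measure M (ball a \<rho>)"
  proof (rule M.finite_measure_eq_AE)
    show "AE x in M. (x \<in> E) = (x \<in> ball a \<rho>)"
      using AE_supp
    proof (rule eventually_mono)
      fix x assume "x \<in> supp M"
      then show "(x \<in> E) = (x \<in> ball a \<rho>)" using AB(3) \<rho>(2)[of a x] ab unfolding E_def by auto
    qed
  qed auto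
  then have E_pos: "measure M E > 0" using ab AB(3) \<rho>(1) unfolding supp_def by auto
  have MA: "measure M (- B) = measure M A"
    using AE_supp AB disj by (intro M.finite_measure_eq_AE) (auto elim!: eventually_mono)
  have lower: "\<omega> \<rho> \<le> h D * (\<theta> * measure M E)" if \<theta>: "0 < \<theta>" "\<theta> \<le> 1" for \<theta>
  proof -
    obtain N where N: "N \<in> borel_probs"
      "\<And>A. A \<in> sets borel \<Longrightarrow> E \<subseteq> A \<Longrightarrow> b \<notin> A \<Longrightarrow> measure N A = measure M A - \<theta> * measure M E"
      "\<And>A. A \<in> sets borel \<Longrightarrow> b \<in> A \<Longrightarrow> measure M A \<le> measure N A"
      "transport_cost h M N \<le> ennreal (h D * (\<theta> * measure M E))"
      by (rule mass_move[OF h M'(1) E_borel ED]) (use \<theta> in auto)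
    interpret N: prob_space N using borel_probsD N by auto
    have "measure N (supp M) = 1"
      using N(3)[of "supp M"] ab AB(3) M' N.prob_le_1[of "supp M"] by auto
    then have N_on: "N \<in> borel_probs_on (supp M)" using N(1) unfolding borel_probs_on_def by auto
    have "measure N (- B) = measure M (- B) - \<theta> * measure M E"
      using ab disj by (intro N(2)) (auto simp: E_def)
    then have "measure N (- B) < measure M A" using MA \<theta> E_pos by simp
    then have "ennreal \<rho> \<le> W_inf M N"
      using \<rho> by (intro W_inf_ge[of A "- B"]) auto
    from cost_ge_of_W_inf_ge[OF \<omega>(2,1) N_on _ this]
    have "ennreal (\<omega> \<rho>) \<le> ennreal (h D * (\<theta> * measure M E))" using \<rho> N(4) by auto
    moreover have "0 \<le> h D" using h \<rho>(1) unfolding pos_nondecreasing_def D_def by auto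
    ultimately show ?thesis using \<theta> by (subst (asm) ennreal_le_iff) auto
  qed
  have \<omega>_pos: "\<omega> \<rho> > 0" using \<omega> \<rho> unfolding pos_nondecreasing_def by auto
  \<comment> \<open>The fraction \<open>\<omega> \<rho> / (2 * c)\<close> makes the upper bound for the cost equal to \<open>\<omega> \<rho> / 2\<close>.\<close>
  define c where "c = h D * measure M E"
  have c_ge: "\<omega> \<rho> \<le> c" using lower[of 1] unfolding c_def by simp
  have "\<omega> \<rho> \<le> c * (\<omega> \<rho> / (2 * c))"
    using lower[of "\<omega> \<rho> / (2 * c)"] \<omega>_pos c_ge
    unfolding mult.left_commute[of "h D"] c_def[symmetric] by (simp add: mult.commute[of c])
  also have "\<dots> = \<omega> \<rho> / 2" using \<omega>_pos c_ge by simp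
  finally show False using \<omega>_pos by simp
qed

text \<open>A failure of total boundedness allows disjoint balls to be picked greedily, but a probability
  measure has room for at most $1/c$ balls of mass at least $c$.\<close>

lemma totally_bounded_of_ball_mass_ge:
  fixes M :: "'a::metric_space measure"
  assumes M: "M \<in> borel_probs" and c: "c > 0" and r: "r > 0"
    and mass: "\<And>x. x \<in> K \<Longrightarrow> c \<le> measure M (ball x r)"
  shows "\<exists>F. finite F \<and> K \<subseteq> (\<Union>x\<in>F. ball x (2 * r))"
proof (rule ccontr)
  interpret prob_space M using borel_probsD M by auto
  note [simp] = borel_probsD(2)[OF M]
  assume no: "\<not> ?thesis"
  have "\<exists>F. finite F \<and> card F = n \<and> F \<subseteq> K \<and> disjoint_family_on (\<lambda>x. ball x r) F" for n
  proof (induction n)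
    case (Suc n)
    then obtain F where F: "finite F" "card F = n" "F \<subseteq> K" "disjoint_family_on (\<lambda>x. ball x r) F" by auto
    then obtain y where y: "y \<in> K" "\<And>x. x \<in> F \<Longrightarrow> 2 * r \<le> dist x y" using no by (force simp: not_less)
    have "ball x r \<inter> ball y r = {}" if "x \<in> F" for x
      using y(2)[OF that] by (intro disjoint_ballI) auto
    moreover have "y \<notin> F" using y(2)[of y] r by auto
    ultimately have "finite (insert y F) \<and> card (insert y F) = Suc n \<and> insert y F \<subseteq> K \<and>
        disjoint_family_on (\<lambda>x. ball x r) (insert y F)"
      using F y by (auto simp: disjoint_family_on_insert Int_commute)
    then show ?case by blast
  qed (auto intro!: exI[of _ "{}"] simp: disjoint_family_on_def)
  moreover obtain n :: nat where n: "1 < real n * c" using reals_Archimedean3[OF c] by auto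
  ultimately obtain F where F: "finite F" "card F = n" "F \<subseteq> K" "disjoint_family_on (\<lambda>x. ball x r) F" by blast
  have "real n * c \<le> (\<Sum>x\<in>F. measure M (ball x r))"
    using sum_bounded_below[of F c "\<lambda>x. measure M (ball x r)"] mass F by auto
  also have "\<dots> = measure M (\<Union>x\<in>F. ball x r)"
    using F by (intro finite_measure_finite_Union[symmetric]) auto
  also have "\<dots> \<le> 1" by (rule prob_le_1)
  finally show False using n by simp
qed

text \<open>For compactness, the balls of a given radius centred in the support must have mass bounded below
  unless a ball of twice the radius covers the support. To see this, move the
  whole mass of \<open>ball x (2 * r)\<close> to a point \<open>b\<close> of the support just outside it, which exists because the support has no gaps. Emptying the ball forces the mass near \<open>x\<close> to
  travel at least \<open>r\<close>, and no moved mass travels more than \<open>6 * r\<close>, so the cost is at most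
  \<open>h (6 * r)\<close> times the mass of the ball and at least \<open>\<omega> r\<close>. That \<open>b\<close> is near \<open>x\<close> is
  essential: the factor of \<open>h\<close> does not depend on \<open>x\<close>.

  Once the support is compact, a disconnection would consist of two compact sets, which lie at
  positive distance from each other.\<close>

lemma supp_compact_connected:
  fixes M :: "'a::complete_space measure" and h \<omega> :: "real \<Rightarrow> real"
  assumes h: "pos_nondecreasing h" "h 0 = 0" and M: "M \<in> borel_probs_on (supp M)"
    and \<omega>: "pos_nondecreasing \<omega>" "cost_bound h M \<omega>"
  shows "compact (supp M)" "connected (supp M)"
proof -
  have M': "M \<in> borel_probs" "measure M (supp M) = 1" using M unfolding borel_probs_on_def by auto
  interpret M: prob_space M using borel_probsD M' by auto
  note [simp] = borel_probsD(2,3)[OF M'(1)]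
  have cl: "closed (supp M)" by (rule supp_closed[OF M'(1)])
  have mass: "\<omega> r \<le> h (6 * r) * measure M (ball x (2 * r))"
    if r: "0 < r" and x: "x \<in> supp M" and big: "\<not> supp M \<subseteq> ball x (4 * r)" for r x
  proof -
    have "\<exists>b\<in>supp M. 2 * r \<le> dist x b \<and> dist x b < 4 * r"
    proof (rule ccontr)
      assume gap: "\<not> ?thesis"
      show False
      proof (rule supp_not_separated[OF h M \<omega>, of "supp M \<inter> cball x (2 * r)" "supp M - ball x (4 * r)" "2 * r"])
        show "2 * r \<le> dist y z" if "y \<in> supp M \<inter> cball x (2 * r)" "z \<in> supp M - ball x (4 * r)" for y z
          using that dist_triangle[of x z y] by auto
        show "supp M \<inter> cball x (2 * r) \<union> (supp M - ball x (4 * r)) = supp M"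
          using gap by (force simp: not_less)
        show "supp M \<inter> cball x (2 * r) \<noteq> {}" using x r by (auto intro!: exI[of _ x])
      qed (use cl big r in \<open>auto intro!: closed_Int closed_Diff\<close>)
    qed
    then obtain b where b: "b \<in> supp M" "2 * r \<le> dist x b" "dist x b < 4 * r" by auto
    have E: "dist u b \<le> 6 * r" if "u \<in> ball x (2 * r)" for u
      using that b dist_triangle[of u b x] by (simp add: dist_commute)
    obtain N where N: "N \<in> borel_probs"
      "\<And>A. A \<in> sets borel \<Longrightarrow> ball x (2 * r) \<subseteq> A \<Longrightarrow> b \<notin> A \<Longrightarrow> measure N A = measure M A - 1 * measure M (ball x (2 * r))"
      "\<And>A. A \<in> sets borel \<Longrightarrow> b \<in> A \<Longrightarrow> measure M A \<le> measure N A"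
      "transport_cost h M N \<le> ennreal (h (6 * r) * (1 * measure M (ball x (2 * r))))"
      by (rule mass_move[OF h M'(1) _ E, where E = "ball x (2 * r)" and \<theta> = 1]) auto
    interpret N: prob_space N using borel_probsD N by auto
    have "measure N (supp M) = 1"
      using N(3)[of "supp M"] b cl M' N.prob_le_1[of "supp M"] by auto
    then have N_on: "N \<in> borel_probs_on (supp M)" using N(1) unfolding borel_probs_on_def by auto
    have "measure N (ball x (2 * r)) = 0" using N(2)[of "ball x (2 * r)"] b by auto
    moreover have "0 < measure M (ball x r)" using x r unfolding supp_def by auto
    ultimately have "ennreal r \<le> W_inf M N"
    proof (intro W_inf_ge[of "ball x r" "ball x (2 * r)"])
      show "r \<le> dist u v" if "u \<in> ball x r" "v \<notin> ball x (2 * r)" for u v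
        using that dist_triangle[of x v u] by auto
    qed auto
    from cost_ge_of_W_inf_ge[OF \<omega>(2,1) N_on _ this]
    have "ennreal (\<omega> r) \<le> ennreal (h (6 * r) * measure M (ball x (2 * r)))" using r N(4) by auto
    moreover have "0 \<le> h (6 * r)" using h r unfolding pos_nondecreasing_def by auto
    ultimately show ?thesis by (subst (asm) ennreal_le_iff) auto
  qed
  have "\<exists>F. finite F \<and> supp M \<subseteq> (\<Union>x\<in>F. ball x e)" if e: "e > 0" for e
  proof -
    define r where "r = e / 4"
    have r: "r > 0" "e = 4 * r" "e = 2 * (2 * r)" using e unfolding r_def by auto
    show "\<exists>F. finite F \<and> supp M \<subseteq> (\<Union>x\<in>F. ball x e)"
    proof (cases "\<exists>x. supp M \<subseteq> ball x e")
      case True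
      then obtain x where "supp M \<subseteq> ball x e" by auto
      then show ?thesis by (intro exI[of _ "{x}"]) auto
    next
      case False
      have hr: "h (6 * r) > 0" "\<omega> r > 0" using h \<omega> r(1) unfolding pos_nondecreasing_def by auto
      have "\<omega> r / h (6 * r) \<le> measure M (ball x (2 * r))" if "x \<in> supp M" for x
        using mass[OF r(1) that] False hr r(2) by (auto simp: divide_le_eq mult.commute)
      then show ?thesis unfolding r(3)
        using hr r(1) by (intro totally_bounded_of_ball_mass_ge[OF M'(1), of "\<omega> r / h (6 * r)"]) auto
    qed
  qed
  then show compact: "compact (supp M)"
    unfolding compact_eq_totally_bounded using cl by (simp add: complete_eq_closed)
  show "connected (supp M)"
    unfolding connected_closed
  proof (intro notI, elim exE conjE)
    fix A B assume AB: "closed A" "closed B" "supp M \<subseteq> A \<union> B" "A \<inter> B \<inter> supp M = {}"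
      "A \<inter> supp M \<noteq> {}" "B \<inter> supp M \<noteq> {}"
    have "\<exists>a\<in>A \<inter> supp M. \<forall>x\<in>A \<inter> supp M. infdist a (B \<inter> supp M) \<le> infdist x (B \<inter> supp M)"
      using AB compact by (intro continuous_attains_inf closed_Int_compact continuous_intros)
    then obtain a where a: "a \<in> A \<inter> supp M"
      "\<And>x. x \<in> A \<inter> supp M \<Longrightarrow> infdist a (B \<inter> supp M) \<le> infdist x (B \<inter> supp M)" by auto
    show False
    proof (rule supp_not_separated[OF h M \<omega>, of "A \<inter> supp M" "B \<inter> supp M" "infdist a (B \<inter> supp M)"])
      show "0 < infdist a (B \<inter> supp M)"
        using a AB cl by (intro infdist_pos_not_in_closed) auto
      show "infdist a (B \<inter> supp M) \<le> dist x y" if "x \<in> A \<inter> supp M" "y \<in> B \<inter> supp M" for x y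
        using a(2)[OF that(1)] infdist_le[OF that(2), of x] by simp
    qed (use AB cl in auto)
  qed
qed

section \<open>The characterisation\<close>

theorem theorem1p1:
  fixes \<mu> :: "'a::complete_space measure" and h :: "real \<Rightarrow> real"
  assumes "pos_nondecreasing h"
    and "\<mu> \<in> borel_probs"
    and "\<mu> \<in> borel_probs_on (supp \<mu>)"
  shows "(h 0 = 0 \<longrightarrow>
            ((\<exists>\<omega>. pos_nondecreasing \<omega> \<and> cost_bound h \<mu> \<omega>) \<longleftrightarrow>
              compact (supp \<mu>) \<and> connected (supp \<mu>))) \<and>
         (compact (supp \<mu>) \<and> connected (supp \<mu>) \<longrightarrow>
            (let \<omega> = (\<lambda>t. 1/2 * min_ball_mass \<mu> (t/17) * h (t/17))
             in pos_nondecreasing \<omega> \<and> cost_bound h \<mu> \<omega>))"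
proof -
  note suff = cost_bound_of_compact_connected[OF assms(1,3)]
  show ?thesis
    unfolding Let_def using suff supp_compact_connected[OF assms(1) _ assms(3)] by blast
qed

end
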